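(* Assume (A0) and (A1), and let $T>0$. Let $u$ be a sub-solution and $v$ a super-solution of $u_t+H(x,u_x)=0$ on $J_T$ with initial condition $u_0$ (i.e. $u(0,\cdot)\le u_0$, $v(0,\cdot)\ge u_0$). Assume there is $C_T>0$ such that for all $(t,x)\in J_T$, $$u(t,x)\le C_T(1+d(x,0)),\qquad v(t,x)\ge -C_T(1+d(x,0)).$$ Then $u\le v$ on $J_T$.
   Context: Junction: fix an integer $N\ge1$ and $N$ distinct unit vectors $e_1,\dots,e_N\in\mathbb{R}^2$. Set $J_i=[0,\infty)e_i$, $J_i^*=J_i\setminus\{0\}$, $J=\bigcup_{i=1}^NJ_i$, $J^*=J\setminus\{0\}$, $I_N=\{1,\dots,N\}$. Each $x\in J_i$ is written $x=x_ie_i$ with $x_i\ge0$. $J$ carries the geodesic distance $d(x,y)=|x-y|$ if $x,y$ lie in a common branch $J_i$, and $d(x,y)=|x|+|y|$ otherwise. For $T>0$, $J_T=(0,T)\times J$; balls $B((t,x),r)$ are taken in $(0,\infty)\times J$. For $u$ defined on $J_T$, $u^i$ is its restriction to $(0,T)\times J_i$, viewed as a function of $(t,x_i)\in(0,T)\times[0,\infty)$. $C^1_*(J_T)$ is the set of continuous $u$ on $J_T$ with each $u^i\in C^1((0,T)\times[0,\infty))$ (one-sided derivative at $x_i=0$); for such $u$, $u_t$ is the time derivative, $u^i_x=\partial u^i/\partial x_i$, $u_x(t,x)=u^i_x(t,x)$ if $x\in J_i^*$, and $u_x(t,0)=(u^1_x(t,0),\dots,u^N_x(t,0))$. (A0):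 $u_0:J\to\mathbb{R}$ is Lipschitz continuous with respect to $d$. (A1): there is $\gamma>0$ such that for each $i\in I_N$, $L_i\in C^2(\mathbb{R})$ with $L_i''\ge\gamma$; $H_i(p)=\sup_{q\in\mathbb{R}}(pq-L_i(q))$ and $H_i^-(p)=\sup_{q\le0}(pq-L_i(q))$. Hamiltonian: $H(x,p)=H_i(p)$ for $x\in J_i^*$, $p\in\mathbb{R}$; $H(0,p)=\max_{i\in I_N}H_i^-(p_i)$ for $p=(p_1,\dots,p_N)\in\mathbb{R}^N$. Viscosity solutions: $u:[0,T)\times J\to\mathbb{R}$ is a sub-solution (resp. super-solution) of $u_t+H(x,u_x)=0$ on $J_T$ if it is upper (resp. lower) semicontinuous and for every $\phi\in C^1_*(J_T)$, every $P=(t,x)\in J_T$ and $r>0$ with $u\le\phi$ (resp. $u\ge\phi$) on $B(P,r)$ and $u(P)=\phi(P)$: if $x\in J_i^*$ then $\phi_t(t,x)+H_i(\phi_x(t,x))\le0$ (resp. $\ge0$); if $x=0$ then $\phi_t(t,0)+\max_{i\in I_N}H_i^-(\phi^i_x(t,0))\le0$ (resp. $\ge0$). It is a sub-solution (resp. super-solution) of the problem with initial condition $u_0$ if in addition $u(0,\cdot)\le u_0$ (resp. $\ge u_0$). *)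

theory Defs
  imports "HOL-Analysis.Analysis"
begin

definition branch :: "(nat \<Rightarrow> real^2) \<Rightarrow> nat \<Rightarrow> (real^2) set" where
  "branch e i = {x. \<exists>s\<ge>0. x = s *\<^sub>R e i}"

definition junction :: "nat \<Rightarrow> (nat \<Rightarrow> real^2) \<Rightarrow> (real^2) set" where
  "junction N e = (\<Union>i\<in>{1..N}. branch e i)"

definition jdist :: "nat \<Rightarrow> (nat \<Rightarrow> real^2) \<Rightarrow> real^2 \<Rightarrow> real^2 \<Rightarrow> real" where
  "jdist N e x y = (if \<exists>i\<in>{1..N}. x \<in> branch e i \<and> y \<in> branch e i
                    then norm (x - y) else norm x + norm y)"

definition admissible_junction :: "nat \<Rightarrow> (nat \<Rightarrow> real^2) \<Rightarrow> bool" where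
  "admissible_junction N e \<longleftrightarrow> N \<ge> 1 \<and> (\<forall>i\<in>{1..N}. norm (e i) = 1) \<and> inj_on e {1..N}"

definition lipschitz_J :: "nat \<Rightarrow> (nat \<Rightarrow> real^2) \<Rightarrow> (real^2 \<Rightarrow> real) \<Rightarrow> bool" where
  "lipschitz_J N e u0 \<longleftrightarrow> (\<exists>K. \<forall>x\<in>junction N e. \<forall>y\<in>junction N e.
      \<bar>u0 x - u0 y\<bar> \<le> K * jdist N e x y)"

definition A1 :: "nat \<Rightarrow> (nat \<Rightarrow> real \<Rightarrow> real) \<Rightarrow> bool" where
  "A1 N L \<longleftrightarrow> (\<exists>\<gamma>>0. \<forall>i\<in>{1..N}. \<exists>L1 L2.
      (\<forall>q. (L i has_real_derivative L1 q) (at q)) \<and>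
      (\<forall>q. (L1 has_real_derivative L2 q) (at q)) \<and>
      continuous_on UNIV L2 \<and> (\<forall>q. L2 q \<ge> \<gamma>))"

definition Hi :: "(nat \<Rightarrow> real \<Rightarrow> real) \<Rightarrow> nat \<Rightarrow> real \<Rightarrow> real" where
  "Hi L i p = (SUP q\<in>UNIV. p * q - L i q)"

definition Hi_minus :: "(nat \<Rightarrow> real \<Rightarrow> real) \<Rightarrow> nat \<Rightarrow> real \<Rightarrow> real" where
  "Hi_minus L i p = (SUP q\<in>{..0}. p * q - L i q)"

text \<open>Test functions in C^1_*(J_T): phi together with the partial derivatives
  pt i t s, px i t s of its branch restrictions phi^i(t,s) = phi t (s e_i),
  which are C^1 on (0,T) x [0,oo) (one-sided derivative at s = 0).\<close>
definition C1_star :: "nat \<Rightarrow> (nat \<Rightarrow> real^2) \<Rightarrow> real \<Rightarrow> (real \<Rightarrow> real^2 \<Rightarrow> real)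
    \<Rightarrow> (nat \<Rightarrow> real \<Rightarrow> real \<Rightarrow> real) \<Rightarrow> (nat \<Rightarrow> real \<Rightarrow> real \<Rightarrow> real) \<Rightarrow> bool" where
  "C1_star N e T \<phi> pt px \<longleftrightarrow>
     (\<forall>t\<in>{0<..<T}. \<forall>x\<in>junction N e. \<forall>\<epsilon>>0. \<exists>\<delta>>0. \<forall>s\<in>{0<..<T}. \<forall>y\<in>junction N e.
         \<bar>s - t\<bar> < \<delta> \<and> jdist N e x y < \<delta> \<longrightarrow> \<bar>\<phi> s y - \<phi> t x\<bar> < \<epsilon>) \<and>
     (\<forall>i\<in>{1..N}.
        (\<forall>t\<in>{0<..<T}. \<forall>s\<in>{0..}.
           ((\<lambda>(t', s'). \<phi> t' (s' *\<^sub>R e i)) has_derivative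
              (\<lambda>(dt, ds). pt i t s * dt + px i t s * ds))
             (at (t, s) within ({0<..<T} \<times> {0..}))) \<and>
        continuous_on ({0<..<T} \<times> {0..}) (\<lambda>(t, s). pt i t s) \<and>
        continuous_on ({0<..<T} \<times> {0..}) (\<lambda>(t, s). px i t s))"

definition usc_J :: "nat \<Rightarrow> (nat \<Rightarrow> real^2) \<Rightarrow> real \<Rightarrow> (real \<Rightarrow> real^2 \<Rightarrow> real) \<Rightarrow> bool" where
  "usc_J N e T u \<longleftrightarrow> (\<forall>t\<in>{0..<T}. \<forall>x\<in>junction N e. \<forall>\<epsilon>>0. \<exists>\<delta>>0.
      \<forall>s\<in>{0..<T}. \<forall>y\<in>junction N e.
        \<bar>s - t\<bar> < \<delta> \<and> jdist N e x y < \<delta> \<longrightarrow> u s y < u t x + \<epsilon>)"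

definition lsc_J :: "nat \<Rightarrow> (nat \<Rightarrow> real^2) \<Rightarrow> real \<Rightarrow> (real \<Rightarrow> real^2 \<Rightarrow> real) \<Rightarrow> bool" where
  "lsc_J N e T u \<longleftrightarrow> (\<forall>t\<in>{0..<T}. \<forall>x\<in>junction N e. \<forall>\<epsilon>>0. \<exists>\<delta>>0.
      \<forall>s\<in>{0..<T}. \<forall>y\<in>junction N e.
        \<bar>s - t\<bar> < \<delta> \<and> jdist N e x y < \<delta> \<longrightarrow> u s y > u t x - \<epsilon>)"

definition ball_JT :: "nat \<Rightarrow> (nat \<Rightarrow> real^2) \<Rightarrow> real \<Rightarrow> real \<Rightarrow> real^2 \<Rightarrow> real \<Rightarrow> (real \<times> (real^2)) set" where
  "ball_JT N e T t x r = {(s, y). s \<in> {0<..<T} \<and> y \<in> junction N e \<and> \<bar>s - t\<bar> < r \<and> jdist N e x y < r}"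

definition subsolution :: "nat \<Rightarrow> (nat \<Rightarrow> real^2) \<Rightarrow> (nat \<Rightarrow> real \<Rightarrow> real) \<Rightarrow> real
    \<Rightarrow> (real \<Rightarrow> real^2 \<Rightarrow> real) \<Rightarrow> bool" where
  "subsolution N e L T u \<longleftrightarrow> usc_J N e T u \<and>
    (\<forall>\<phi> pt px t x r. C1_star N e T \<phi> pt px \<and> t \<in> {0<..<T} \<and> x \<in> junction N e \<and> r > 0 \<and>
       (\<forall>(s, y)\<in>ball_JT N e T t x r. u s y \<le> \<phi> s y) \<and> u t x = \<phi> t x \<longrightarrow>
       (\<forall>i\<in>{1..N}. x \<in> branch e i \<and> x \<noteq> 0 \<longrightarrow>
           pt i t (norm x) + Hi L i (px i t (norm x)) \<le> 0) \<and>
       (x = 0 \<longrightarrow> pt 1 t 0 + Max ((\<lambda>i. Hi_minus L i (px i t 0)) ` {1..N}) \<le> 0))"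

definition supersolution :: "nat \<Rightarrow> (nat \<Rightarrow> real^2) \<Rightarrow> (nat \<Rightarrow> real \<Rightarrow> real) \<Rightarrow> real
    \<Rightarrow> (real \<Rightarrow> real^2 \<Rightarrow> real) \<Rightarrow> bool" where
  "supersolution N e L T u \<longleftrightarrow> lsc_J N e T u \<and>
    (\<forall>\<phi> pt px t x r. C1_star N e T \<phi> pt px \<and> t \<in> {0<..<T} \<and> x \<in> junction N e \<and> r > 0 \<and>
       (\<forall>(s, y)\<in>ball_JT N e T t x r. u s y \<ge> \<phi> s y) \<and> u t x = \<phi> t x \<longrightarrow>
       (\<forall>i\<in>{1..N}. x \<in> branch e i \<and> x \<noteq> 0 \<longrightarrow>
           pt i t (norm x) + Hi L i (px i t (norm x)) \<ge> 0) \<and>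
       (x = 0 \<longrightarrow> pt 1 t 0 + Max ((\<lambda>i. Hi_minus L i (px i t 0)) ` {1..N}) \<ge> 0))"

end

theory Submission
  imports Defs
begin

text \<open>
  No doubling of variables is needed: convexity lets one replace the subsolution by a \<open>C\<^sup>1\<close> strict
  subsolution, which is itself a test function for the supersolution.

  Since \<open>H\<^sub>i\<close> is a supremum of affine functions, being a subsolution on a branch means satisfying
  the transport inequalities \<open>u\<^sub>t + q u\<^sub>x \<le> L\<^sub>i(q)\<close> for all \<open>q\<close>, and the junction condition supplies those
  with \<open>q \<le> 0\<close> at the vertex. Integrated along lines they read
  \<open>u(t + h, y) \<le> u(t, x) + h L\<^sub>i((y - x) / h)\<close>. This form is stable under minima, suprema of time
  translates and averages. After adding a multiple of \<open>t\<close> one may assume \<open>L\<^sub>i(q) \<ge> K |q|\<close>, and then: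
  a minimum with a decreasing cone gives coercivity at infinity; the running supremum in time
  gives a Lipschitz function; averaging over \<open>[t, t + \<epsilon>] \<times> [x, x + \<delta>]\<close>, always away from the
  vertex, gives a \<open>C\<^sup>1\<close> function on each branch. The branchwise averages disagree at the vertex,
  but correcting them by a function of \<open>t\<close> costs only \<open>O(\<delta> / \<epsilon>)\<close> in the equation.
\<close>

text \<open>The obstacle is the jump of the Hamiltonian at the vertex. Penalising the distance of
  two points produces slopes on two possibly different branches, with no evident relation between
  \<open>H_i^-\<close> on one and \<open>H_j\<close> on the other. With a single smooth comparison
  function both conditions are read at one point, and the vertex asks only for velocities
  \<open>q \<le> 0\<close>: those whose line, followed backwards from the vertex, stays in the
  branch.

  The lower bound \<open>K |q|\<close> serves twice. Cones of slope \<open>-K\<close> then satisfy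
  the inequality along lines, and with \<open>K\<close> above the growth constant of
  \<open>v\<close> the capped function minus \<open>v\<close> tends to minus infinity on every
  branch. It also lets the initial datum, whose Lipschitz constant is at most \<open>K\<close>, act
  as a subsolution at negative times.

  The order matters: the cap keeps the running supremum finite; the supremum supplies the continuity
  from which averages gain classical derivatives, and it is defined for all times, so that averages
  over \<open>[t, t + \<epsilon>]\<close> may look beyond \<open>T\<close>.\<close>

declare One_nat_def [simp del]

subsection \<open>Test functions given branch by branch\<close>

text \<open>Away from 0 exactly one branch of an admissible junction qualifies. At 0 all of them do,
  so the choice is harmless only for families with a common vertex value.\<close>

definition glue :: "nat \<Rightarrow> (nat \<Rightarrow> real^2) \<Rightarrow> (nat \<Rightarrow> real \<Rightarrow> real \<Rightarrow> real) \<Rightarrow> real \<Rightarrow> real^2 \<Rightarrow> real" where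
  "glue N e \<phi> t x = \<phi> (SOME i. i \<in> {1..N} \<and> x \<in> branch e i) t (norm x)"

text \<open>Equal vertex values replace the continuity clause of \<open>C1_star\<close>, which then
  follows from differentiability on each closed branch.\<close>

definition C1_branches :: "nat \<Rightarrow> real \<Rightarrow> (nat \<Rightarrow> real \<Rightarrow> real \<Rightarrow> real)
    \<Rightarrow> (nat \<Rightarrow> real \<Rightarrow> real \<Rightarrow> real) \<Rightarrow> (nat \<Rightarrow> real \<Rightarrow> real \<Rightarrow> real) \<Rightarrow> bool" where
  "C1_branches N T \<phi> pt px \<longleftrightarrow>
     (\<forall>i\<in>{1..N}. \<forall>j\<in>{1..N}. \<forall>t. \<phi> i t 0 = \<phi> j t 0) \<and>
     (\<forall>i\<in>{1..N}.
        (\<forall>t\<in>{0<..<T}. \<forall>s\<in>{0..}.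
           ((\<lambda>(t', s'). \<phi> i t' s') has_derivative
              (\<lambda>(dt, ds). pt i t s * dt + px i t s * ds))
             (at (t, s) within ({0<..<T} \<times> {0..}))) \<and>
        continuous_on ({0<..<T} \<times> {0..}) (\<lambda>(t, s). pt i t s) \<and>
        continuous_on ({0<..<T} \<times> {0..}) (\<lambda>(t, s). px i t s))"

lemma C1_branches_add_const:
  assumes "C1_branches N T \<phi> pt px"
  shows "C1_branches N T (\<lambda>i t s. \<phi> i t s + c) pt px"
  unfolding C1_branches_def
proof (intro conjI ballI allI)
  fix i t s assume i: "i \<in> {1..N}" and ts: "t \<in> {0<..<T}" "s \<in> {0::real..}"
  have "((\<lambda>z. (\<lambda>(t', s'). \<phi> i t' s') z + c) has_derivative (\<lambda>(dt, ds). pt i t s * dt + px i t s * ds))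
         (at (t, s) within {0<..<T} \<times> {0..})"
    using assms i ts unfolding C1_branches_def by (intro has_derivative_add_const) blast
  then show "((\<lambda>(t', s'). \<phi> i t' s' + c) has_derivative (\<lambda>(dt, ds). pt i t s * dt + px i t s * ds))
         (at (t, s) within {0<..<T} \<times> {0..})"
    by (simp add: case_prod_unfold)
next
  fix i j t assume "i \<in> {1..N}" "j \<in> {1..N}"
  then have "\<phi> i t 0 = \<phi> j t 0" using assms unfolding C1_branches_def by blast
  then show "\<phi> i t 0 + c = \<phi> j t 0 + c" by simp
next
  fix i assume "i \<in> {1..N}"
  then show "continuous_on ({0<..<T} \<times> {0..}) (\<lambda>(t, s). pt i t s)"
    "continuous_on ({0<..<T} \<times> {0..}) (\<lambda>(t, s). px i t s)"
    using assms unfolding C1_branches_def by blast+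
qed

section \<open>Geometry of the junction in branch coordinates\<close>

lemma scaleR_in_branch: "0 \<le> s \<Longrightarrow> s *\<^sub>R e i \<in> branch e i"
  by (auto simp: branch_def)

lemma scaleR_in_junction: "i \<in> {1..N} \<Longrightarrow> 0 \<le> s \<Longrightarrow> s *\<^sub>R e i \<in> junction N e"
  unfolding junction_def using scaleR_in_branch by blast

lemma junction_cases:
  assumes "x \<in> junction N e"
  obtains i s where "i \<in> {1..N}" "0 \<le> s" "x = s *\<^sub>R e i"
  using assms unfolding junction_def branch_def by auto

lemma jdist_zero: "jdist N e 0 x = norm x" "jdist N e x 0 = norm x"
  by (auto simp: jdist_def)

context
  fixes N :: nat and e :: "nat \<Rightarrow> real^2"
  assumes adm: "admissible_junction N e"
begin

lemma norm_e: "i \<in> {1..N} \<Longrightarrow> norm (e i) = 1"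
  using adm by (auto simp: admissible_junction_def)

lemma norm_scaleR_e: "i \<in> {1..N} \<Longrightarrow> 0 \<le> s \<Longrightarrow> norm (s *\<^sub>R e i) = s"
  by (simp add: norm_e)

lemma branch_index_unique:
  assumes "i \<in> {1..N}" "j \<in> {1..N}" "0 < s" "s *\<^sub>R e i \<in> branch e j"
  shows "i = j"
proof -
  obtain r where r: "0 \<le> r" "s *\<^sub>R e i = r *\<^sub>R e j" using assms(4) by (auto simp: branch_def)
  have "s = norm (s *\<^sub>R e i)" using norm_scaleR_e[of i s] assms by simp
  also have "\<dots> = r" using norm_scaleR_e[of j r] r assms by simp
  finally have "e i = e j" using r assms(3) by simp
  moreover have "inj_on e {1..N}" using adm by (simp add: admissible_junction_def)
  ultimately show ?thesis using assms(1,2) by (simp only: inj_on_def)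
qed

lemma jdist_same_branch:
  assumes "i \<in> {1..N}" "0 \<le> s" "0 \<le> r"
  shows "jdist N e (s *\<^sub>R e i) (r *\<^sub>R e i) = \<bar>s - r\<bar>"
proof -
  have "norm (s *\<^sub>R e i - r *\<^sub>R e i) = \<bar>s - r\<bar>"
    by (simp add: scaleR_left_diff_distrib[symmetric] norm_e[OF assms(1)])
  moreover have "\<exists>j\<in>{1..N}. s *\<^sub>R e i \<in> branch e j \<and> r *\<^sub>R e i \<in> branch e j"
    using assms scaleR_in_branch by blast
  ultimately show ?thesis
    unfolding jdist_def by (simp only: if_True)
qed

text \<open>Any point of another branch is reached through the vertex, hence lies at distance at
  least \<open>s\<close>.\<close>

lemma near_in_branch:
  assumes "i \<in> {1..N}" "0 < s" "jdist N e (s *\<^sub>R e i) y < s"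
  shows "y \<in> branch e i"
proof -
  have "\<exists>k\<in>{1..N}. s *\<^sub>R e i \<in> branch e k \<and> y \<in> branch e k"
  proof (rule ccontr)
    assume "\<not> ?thesis"
    then have "jdist N e (s *\<^sub>R e i) y = norm (s *\<^sub>R e i) + norm y"
      unfolding jdist_def by (simp only: if_False)
    then show False using norm_scaleR_e[of i s] assms by simp
  qed
  then show ?thesis using branch_index_unique[OF assms(1) _ assms(2)] by blast
qed

lemma glue_branch:
  assumes "\<And>i j t. i \<in> {1..N} \<Longrightarrow> j \<in> {1..N} \<Longrightarrow> \<phi> i t 0 = \<phi> j t (0::real)"
    and i: "i \<in> {1..N}" and s: "0 \<le> s"
  shows "glue N e \<phi> t (s *\<^sub>R e i) = \<phi> i t s"
proof -
  define j where "j = (SOME j. j \<in> {1..N} \<and> s *\<^sub>R e i \<in> branch e j)"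
  have j: "j \<in> {1..N} \<and> s *\<^sub>R e i \<in> branch e j"
    unfolding j_def by (rule someI[of _ i]) (use i s scaleR_in_branch in auto)
  have "\<phi> j t s = \<phi> i t s"
  proof (cases "s = 0")
    case True then show ?thesis using assms(1)[of j i] j i by simp
  next
    case False then show ?thesis using branch_index_unique[of i j s] i j s by auto
  qed
  then show ?thesis
    unfolding glue_def j_def[symmetric] using norm_scaleR_e[OF i s] by simp
qed

lemma C1_star_glue:
  assumes C1: "C1_branches N T \<phi> pt px"
  shows "C1_star N e T (glue N e \<phi>) pt px"
  unfolding C1_star_def
proof (intro conjI ballI allI impI)
  have gl: "i \<in> {1..N} \<Longrightarrow> 0 \<le> s \<Longrightarrow> glue N e \<phi> t (s *\<^sub>R e i) = \<phi> i t s" for i t s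
    using glue_branch C1 unfolding C1_branches_def by blast
  have cont: "continuous_on ({0<..<T} \<times> {0..}) (\<lambda>(t, s). \<phi> i t s)" if "i \<in> {1..N}" for i
  proof (rule has_derivative_continuous_on)
    fix z assume "z \<in> {0<..<T} \<times> {0::real..}"
    then obtain t s where "z = (t, s)" "t \<in> {0<..<T}" "s \<in> {0::real..}" by blast
    then show "((\<lambda>(t, s). \<phi> i t s) has_derivative
        (\<lambda>(dt, ds). pt i (fst z) (snd z) * dt + px i (fst z) (snd z) * ds)) (at z within {0<..<T} \<times> {0..})"
      using C1 that unfolding C1_branches_def by simp
  qed
  have near: "\<exists>\<delta>>0. \<forall>t'\<in>{0<..<T}. \<forall>s'\<ge>0. \<bar>t' - t\<bar> < \<delta> \<and> \<bar>s' - s\<bar> < \<delta> \<longrightarrow>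
      \<bar>\<phi> i t' s' - \<phi> i t s\<bar> < \<epsilon>" if i: "i \<in> {1..N}" and ts: "t \<in> {0<..<T}" "0 \<le> s" and "0 < \<epsilon>" for i t s \<epsilon>
  proof -
    obtain d where d: "d > 0" "\<forall>z\<in>{0<..<T} \<times> {0..}. dist z (t, s) < d \<longrightarrow>
        dist ((\<lambda>(t, s). \<phi> i t s) z) (\<phi> i t s) < \<epsilon>"
      using cont[OF i, unfolded continuous_on_iff, rule_format, of "(t, s)" \<epsilon>] ts \<open>0 < \<epsilon>\<close> by auto
    have "dist (t', s') (t, s) < d" if "\<bar>t' - t\<bar> < d / 2" "\<bar>s' - s\<bar> < d / 2" for t' s'
    proof -
      have "dist (t', s') (t, s) \<le> dist t' t + dist s' s"
        unfolding dist_Pair_Pair by (rule order_trans[OF sqrt_sum_squares_le_sum]) auto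
      then show ?thesis using that by (simp add: dist_real_def)
    qed
    then show ?thesis using d by (intro exI[of _ "d/2"]) (auto simp: dist_real_def)
  qed
  fix t x \<epsilon> assume t: "t \<in> {0<..<T}" and x: "x \<in> junction N e" and eps: "(0::real) < \<epsilon>"
  obtain i s where ks: "i \<in> {1..N}" "0 \<le> s" "x = s *\<^sub>R e i" using junction_cases[OF x] by blast
  show "\<exists>\<delta>>0. \<forall>t'\<in>{0<..<T}. \<forall>y\<in>junction N e. \<bar>t' - t\<bar> < \<delta> \<and> jdist N e x y < \<delta> \<longrightarrow>
      \<bar>glue N e \<phi> t' y - glue N e \<phi> t x\<bar> < \<epsilon>"
  proof (cases "s = 0")
    case False
    obtain d where d: "d > 0" "\<forall>t'\<in>{0<..<T}. \<forall>s'\<ge>0. \<bar>t' - t\<bar> < d \<and> \<bar>s' - s\<bar> < d \<longrightarrow>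
      \<bar>\<phi> i t' s' - \<phi> i t s\<bar> < \<epsilon>" using near[OF ks(1) t ks(2) eps] by blast
    \<comment> \<open>A radius of at most \<open>s\<close> keeps the ball inside branch
      \<open>i\<close>, where only one coordinate function is involved.\<close>
    show ?thesis
    proof (intro exI[of _ "min d s"] conjI ballI impI)
      show "0 < min d s" using d False ks by auto
      fix t' y assume a: "t' \<in> {0<..<T}" "y \<in> junction N e" "\<bar>t' - t\<bar> < min d s \<and> jdist N e x y < min d s"
      then have "y \<in> branch e i" using near_in_branch[of i s y] ks False by auto
      then obtain s' where s': "0 \<le> s'" "y = s' *\<^sub>R e i" by (auto simp: branch_def)
      then have "\<bar>s' - s\<bar> < d" using a jdist_same_branch[of i s s'] ks by auto
      then show "\<bar>glue N e \<phi> t' y - glue N e \<phi> t x\<bar> < \<epsilon>" using d a s' ks gl by auto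
    qed
  next
    case True
    have "\<forall>j\<in>{1..N}. \<exists>d>0. \<forall>t'\<in>{0<..<T}. \<forall>s'\<ge>0. \<bar>t' - t\<bar> < d \<and> \<bar>s' - 0\<bar> < d \<longrightarrow>
      \<bar>\<phi> j t' s' - \<phi> j t 0\<bar> < \<epsilon>" using near[OF _ t order_refl eps] by blast
    from bchoice[OF this] obtain d where d': "\<forall>j\<in>{1..N}. d j > 0 \<and>
      (\<forall>t'\<in>{0<..<T}. \<forall>s'\<ge>0. \<bar>t' - t\<bar> < d j \<and> \<bar>s' - 0\<bar> < d j \<longrightarrow> \<bar>\<phi> j t' s' - \<phi> j t 0\<bar> < \<epsilon>)"
      by blast
    have d: "\<And>j. j\<in>{1..N} \<Longrightarrow> d j > 0"
      "\<And>j t' s'. j\<in>{1..N} \<Longrightarrow> t'\<in>{0<..<T} \<Longrightarrow> s'\<ge>0 \<Longrightarrow> \<bar>t' - t\<bar> < d j \<Longrightarrow> \<bar>s'\<bar> < d j \<Longrightarrow>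
      \<bar>\<phi> j t' s' - \<phi> j t 0\<bar> < \<epsilon>"
      using d' by simp_all
    \<comment> \<open>Near the vertex all branches occur at once; finitely many radii have a
      positive minimum.\<close>
    define D where "D = Min (d ` {1..N})"
    have ne: "d ` {1..N} \<noteq> {}" using ks by auto
    have Dpos: "0 < D" unfolding D_def using d(1) ne by (subst Min_gr_iff) auto
    have Dle: "D \<le> d j" if "j \<in> {1..N}" for j unfolding D_def using that by auto
    show ?thesis
    proof (intro exI[of _ D] conjI ballI impI)
      show "0 < D" by fact
      fix t' y assume a: "t' \<in> {0<..<T}" "y \<in> junction N e" "\<bar>t' - t\<bar> < D \<and> jdist N e x y < D"
      obtain j s' where j: "j \<in> {1..N}" "0 \<le> s'" "y = s' *\<^sub>R e j" using junction_cases[OF a(2)] by blast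
      have "x = 0" using ks True by simp
      then have "s' < D" using a jdist_zero(1)[of N e y] j norm_e[of j] by simp
      moreover have "glue N e \<phi> t x = \<phi> j t 0" using gl[of j 0 t] j \<open>x = 0\<close> by simp
      moreover have "glue N e \<phi> t' y = \<phi> j t' s'" using gl j by simp
      ultimately show "\<bar>glue N e \<phi> t' y - glue N e \<phi> t x\<bar> < \<epsilon>" using d(2)[of j t' s'] Dle[of j] a j by auto
    qed
  qed
next
  fix i t s assume i: "i \<in> {1..N}" and t: "t \<in> {0<..<T}" and s: "s \<in> {0::real..}"
  have gl: "i \<in> {1..N} \<Longrightarrow> 0 \<le> s \<Longrightarrow> glue N e \<phi> t (s *\<^sub>R e i) = \<phi> i t s" for i t s
    using glue_branch C1 unfolding C1_branches_def by blast
  have "((\<lambda>(t', s'). \<phi> i t' s') has_derivative (\<lambda>(dt, ds). pt i t s * dt + px i t s * ds))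
         (at (t, s) within {0<..<T} \<times> {0..})"
    using C1 i t s unfolding C1_branches_def by blast
  then show "((\<lambda>(t', s'). glue N e \<phi> t' (s' *\<^sub>R e i)) has_derivative
      (\<lambda>(dt, ds). pt i t s * dt + px i t s * ds)) (at (t, s) within {0<..<T} \<times> {0..})"
    by (rule has_derivative_transform[rotated 2]) (use gl i t s in auto)
next
  fix i assume i: "i \<in> {1..N}"
  show "continuous_on ({0<..<T} \<times> {0..}) (\<lambda>(t, s). pt i t s)"
    "continuous_on ({0<..<T} \<times> {0..}) (\<lambda>(t, s). px i t s)"
    using C1 i unfolding C1_branches_def by blast+
qed

section \<open>Viscosity inequalities at local extrema\<close>

text \<open>Adding the constant \<open>c\<close> turns a local maximum of the difference into
  contact from above. At the vertex a bound on the maximum of the \<open>H_i^-\<close> is a bound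
  for every \<open>i\<close>.\<close>

lemma subsolution_test:
  assumes sub: "subsolution N e L T u" and C1: "C1_branches N T \<phi> pt px"
    and k: "k \<in> {1..N}" and t: "0 < t" "t < T" and s: "0 \<le> s" and r: "0 < r"
    and max: "\<And>i t' s'. i \<in> {1..N} \<Longrightarrow> 0 < t' \<Longrightarrow> t' < T \<Longrightarrow> \<bar>t' - t\<bar> < r \<Longrightarrow> 0 \<le> s' \<Longrightarrow>
       u t' (s' *\<^sub>R e i) - \<phi> i t' s' \<le> u t (s *\<^sub>R e k) - \<phi> k t s"
  shows "0 < s \<Longrightarrow> pt k t s + Hi L k (px k t s) \<le> 0"
    and "s = 0 \<Longrightarrow> i \<in> {1..N} \<Longrightarrow> pt 1 t 0 + Hi_minus L i (px i t 0) \<le> 0"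
proof -
  define c where "c = u t (s *\<^sub>R e k) - \<phi> k t s"
  define \<psi> where "\<psi> = (\<lambda>i t s. \<phi> i t s + c)"
  have C1': "C1_branches N T \<psi> pt px"
    unfolding \<psi>_def by (rule C1_branches_add_const[OF C1])
  have gl: "i \<in> {1..N} \<Longrightarrow> 0 \<le> s \<Longrightarrow> glue N e \<psi> t (s *\<^sub>R e i) = \<psi> i t s" for i t s
    using glue_branch C1' unfolding C1_branches_def by blast
  have "\<forall>(t', y)\<in>ball_JT N e T t (s *\<^sub>R e k) r. u t' y \<le> glue N e \<psi> t' y"
  proof clarify
    fix t' y assume a: "(t', y) \<in> ball_JT N e T t (s *\<^sub>R e k) r"
    then obtain j s' where j: "j \<in> {1..N}" "0 \<le> s'" "y = s' *\<^sub>R e j"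
      using junction_cases unfolding ball_JT_def by blast
    then show "u t' y \<le> glue N e \<psi> t' y"
      using max[of j t' s'] a gl[of j s' t'] unfolding ball_JT_def \<psi>_def c_def by auto
  qed
  moreover have "u t (s *\<^sub>R e k) = glue N e \<psi> t (s *\<^sub>R e k)"
    using gl[OF k s] by (simp add: \<psi>_def c_def)
  ultimately have *: "(\<forall>i\<in>{1..N}. s *\<^sub>R e k \<in> branch e i \<and> s *\<^sub>R e k \<noteq> 0 \<longrightarrow>
           pt i t (norm (s *\<^sub>R e k)) + Hi L i (px i t (norm (s *\<^sub>R e k))) \<le> 0) \<and>
       (s *\<^sub>R e k = 0 \<longrightarrow> pt 1 t 0 + Max ((\<lambda>i. Hi_minus L i (px i t 0)) ` {1..N}) \<le> 0)"
    using C1_star_glue[OF C1'] t scaleR_in_junction[OF k s] r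
    by (intro sub[unfolded subsolution_def, THEN conjunct2, THEN spec, THEN spec, THEN spec, THEN spec,
          THEN spec, THEN spec, THEN mp, of "glue N e \<psi>" pt px t "s *\<^sub>R e k" r] conjI) simp_all
  show "pt k t s + Hi L k (px k t s) \<le> 0" if "0 < s"
  proof -
    have "s *\<^sub>R e k \<noteq> 0" using that norm_e[OF k] by auto
    then show ?thesis
      using conjunct1[OF *] k scaleR_in_branch[OF s, of e k] unfolding norm_scaleR_e[OF k s] by blast
  qed
  show "pt 1 t 0 + Hi_minus L i (px i t 0) \<le> 0" if "s = 0" "i \<in> {1..N}"
  proof -
    have "Hi_minus L i (px i t 0) \<le> Max ((\<lambda>i. Hi_minus L i (px i t 0)) ` {1..N})"
      using that by (intro Max_ge) auto
    moreover have "pt 1 t 0 + Max ((\<lambda>i. Hi_minus L i (px i t 0)) ` {1..N}) \<le> 0"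
      using * that by simp
    ultimately show ?thesis by linarith
  qed
qed

text \<open>Here the vertex condition bounds a maximum from below, which yields the inequality for
  one index only: a branch where the maximum is attained.\<close>

lemma supersolution_test:
  assumes super: "supersolution N e L T v" and C1: "C1_branches N T \<phi> pt px"
    and k: "k \<in> {1..N}" and t: "0 < t" "t < T" and s: "0 \<le> s" and r: "0 < r"
    and max: "\<And>i t' s'. i \<in> {1..N} \<Longrightarrow> 0 < t' \<Longrightarrow> t' < T \<Longrightarrow> \<bar>t' - t\<bar> < r \<Longrightarrow> 0 \<le> s' \<Longrightarrow>
       \<phi> i t' s' - v t' (s' *\<^sub>R e i) \<le> \<phi> k t s - v t (s *\<^sub>R e k)"
  shows "0 < s \<Longrightarrow> 0 \<le> pt k t s + Hi L k (px k t s)"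
    and "s = 0 \<Longrightarrow> \<exists>i\<in>{1..N}. 0 \<le> pt 1 t 0 + Hi_minus L i (px i t 0)"
proof -
  define c where "c = v t (s *\<^sub>R e k) - \<phi> k t s"
  define \<psi> where "\<psi> = (\<lambda>i t s. \<phi> i t s + c)"
  have C1': "C1_branches N T \<psi> pt px"
    unfolding \<psi>_def by (rule C1_branches_add_const[OF C1])
  have gl: "i \<in> {1..N} \<Longrightarrow> 0 \<le> s \<Longrightarrow> glue N e \<psi> t (s *\<^sub>R e i) = \<psi> i t s" for i t s
    using glue_branch C1' unfolding C1_branches_def by blast
  have "\<forall>(t', y)\<in>ball_JT N e T t (s *\<^sub>R e k) r. v t' y \<ge> glue N e \<psi> t' y"
  proof clarify
    fix t' y assume a: "(t', y) \<in> ball_JT N e T t (s *\<^sub>R e k) r"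
    then obtain j s' where j: "j \<in> {1..N}" "0 \<le> s'" "y = s' *\<^sub>R e j"
      using junction_cases unfolding ball_JT_def by blast
    then show "v t' y \<ge> glue N e \<psi> t' y"
      using max[of j t' s'] a gl[of j s' t'] unfolding ball_JT_def \<psi>_def c_def by auto
  qed
  moreover have "v t (s *\<^sub>R e k) = glue N e \<psi> t (s *\<^sub>R e k)"
    using gl[OF k s] by (simp add: \<psi>_def c_def)
  ultimately have *: "(\<forall>i\<in>{1..N}. s *\<^sub>R e k \<in> branch e i \<and> s *\<^sub>R e k \<noteq> 0 \<longrightarrow>
           pt i t (norm (s *\<^sub>R e k)) + Hi L i (px i t (norm (s *\<^sub>R e k))) \<ge> 0) \<and>
       (s *\<^sub>R e k = 0 \<longrightarrow> pt 1 t 0 + Max ((\<lambda>i. Hi_minus L i (px i t 0)) ` {1..N}) \<ge> 0)"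
    using C1_star_glue[OF C1'] t scaleR_in_junction[OF k s] r
    by (intro super[unfolded supersolution_def, THEN conjunct2, THEN spec, THEN spec, THEN spec, THEN spec,
          THEN spec, THEN spec, THEN mp, of "glue N e \<psi>" pt px t "s *\<^sub>R e k" r] conjI) simp_all
  show "0 \<le> pt k t s + Hi L k (px k t s)" if "0 < s"
  proof -
    have "s *\<^sub>R e k \<noteq> 0" using that norm_e[OF k] by auto
    then show ?thesis
      using conjunct1[OF *] k scaleR_in_branch[OF s, of e k] unfolding norm_scaleR_e[OF k s] by blast
  qed
  show "\<exists>i\<in>{1..N}. 0 \<le> pt 1 t 0 + Hi_minus L i (px i t 0)" if "s = 0"
  proof -
    have "Max ((\<lambda>i. Hi_minus L i (px i t 0)) ` {1..N}) \<in> (\<lambda>i. Hi_minus L i (px i t 0)) ` {1..N}"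
      using k by (intro Max_in) auto
    then show ?thesis using * that by auto
  qed
qed

end

subsection \<open>Attained maxima and partial derivatives\<close>

text \<open>Were no point maximal, each \<open>x\<close> would have a better point
  \<open>g x\<close>, which still beats \<open>f\<close> near \<open>x\<close>. Among finitely many
  such neighbourhoods covering \<open>K\<close>, the best \<open>g z\<close> lies in one of them and
  is beaten again.\<close>

lemma upper_semicontinuous_attains_max:
  fixes f :: "'a::metric_space \<Rightarrow> real"
  assumes K: "compact K" "K \<noteq> {}"
    and usc: "\<And>x \<epsilon>. x \<in> K \<Longrightarrow> 0 < \<epsilon> \<Longrightarrow> \<exists>\<delta>>0. \<forall>y\<in>K. dist y x < \<delta> \<longrightarrow> f y < f x + \<epsilon>"
  shows "\<exists>x\<in>K. \<forall>y\<in>K. f y \<le> f x"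
proof (rule ccontr)
  assume "\<not> ?thesis"
  then have "\<forall>x\<in>K. \<exists>y. y \<in> K \<and> f x < f y" by (auto simp: not_le)
  from bchoice[OF this] obtain g where g: "\<forall>x\<in>K. g x \<in> K \<and> f x < f (g x)" by blast
  have "\<forall>x\<in>K. \<exists>\<delta>>0. \<forall>y\<in>K. dist y x < \<delta> \<longrightarrow> f y < f (g x)"
  proof
    fix x assume x: "x \<in> K"
    then show "\<exists>\<delta>>0. \<forall>y\<in>K. dist y x < \<delta> \<longrightarrow> f y < f (g x)"
      using usc[OF x, of "f (g x) - f x"] g by auto
  qed
  from bchoice[OF this] obtain \<delta> where
    \<delta>: "\<forall>x\<in>K. \<delta> x > 0 \<and> (\<forall>y\<in>K. dist y x < \<delta> x \<longrightarrow> f y < f (g x))" by blast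
  obtain D where D: "D \<subseteq> K" "finite D" "K \<subseteq> (\<Union>x\<in>D. ball x (\<delta> x))"
    using compactE_image[OF K(1), of K "\<lambda>x. ball x (\<delta> x)"] \<delta>
    by (metis (no_types, lifting) UN_I centre_in_ball open_ball subsetI)
  have ne: "D \<noteq> {}" using D K(2) by auto
  define m where "m = Max ((\<lambda>x. f (g x)) ` D)"
  have "m \<in> (\<lambda>x. f (g x)) ` D" unfolding m_def using ne D by (intro Max_in) auto
  then obtain z where z: "z \<in> D" "m = f (g z)" by auto
  have "g z \<in> K" using z D g by auto
  then obtain x where x: "x \<in> D" "g z \<in> ball x (\<delta> x)" using D by blast
  then have "f (g z) < f (g x)" using \<delta> D \<open>g z \<in> K\<close> by (auto simp: dist_commute)
  moreover have "f (g x) \<le> m" unfolding m_def using x D by (intro Max_ge) auto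
  ultimately show False using z by simp
qed

text \<open>The domain is unbounded in \<open>s\<close> and open at \<open>T\<close>. The upper
  bound pushes \<open>f\<close> below its values at \<open>(a, 0)\<close> near both ends, so a
  compact rectangle carries the maximum.\<close>

lemma coercive_usc_attains_max:
  fixes f :: "nat \<Rightarrow> real \<Rightarrow> real \<Rightarrow> real"
  assumes N: "1 \<le> N" and aT: "a < T" and \<kappa>: "0 < \<kappa>"
    and usc: "\<And>i t s \<epsilon>. i \<in> {1..N} \<Longrightarrow> a \<le> t \<Longrightarrow> t < T \<Longrightarrow> 0 \<le> s \<Longrightarrow> 0 < \<epsilon> \<Longrightarrow>
      \<exists>\<delta>>0. \<forall>t' s'. a \<le> t' \<and> t' < T \<and> 0 \<le> s' \<and> \<bar>t' - t\<bar> < \<delta> \<and> \<bar>s' - s\<bar> < \<delta> \<longrightarrow> f i t' s' < f i t s + \<epsilon>"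
    and bnd: "\<And>i t s. i \<in> {1..N} \<Longrightarrow> a \<le> t \<Longrightarrow> t < T \<Longrightarrow> 0 \<le> s \<Longrightarrow> f i t s \<le> Q - s - \<kappa> / (T - t)"
  obtains k t s where "k \<in> {1..N}" "a \<le> t" "t < T" "0 \<le> s"
    "\<And>i t' s'. i \<in> {1..N} \<Longrightarrow> a \<le> t' \<Longrightarrow> t' < T \<Longrightarrow> 0 \<le> s' \<Longrightarrow> f i t' s' \<le> f k t s"
proof -
  define m where "m = Min ((\<lambda>i. f i a 0) ` {1..N})"
  have m: "m \<le> f i a 0" if "i \<in> {1..N}" for i unfolding m_def using that by (intro Min_le) auto
  \<comment> \<open>Chosen so that \<open>Q - \<rho> < m\<close>; the same number is the threshold
    for \<open>s\<close> and, through \<open>b\<close>, for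
    \<open>\<kappa> / (T - t)\<close>.\<close>
  define \<rho> where "\<rho> = \<bar>Q - m\<bar> + 1"
  have \<rho>: "0 < \<rho>" by (simp add: \<rho>_def)
  define b where "b = max a (T - \<kappa> / \<rho>)"
  have b: "a \<le> b" "b < T" using aT \<kappa> \<rho> by (auto simp: b_def)
  have out: "f i t s < m" if i: "i \<in> {1..N}" and ts: "a \<le> t" "t < T" "0 \<le> s" and o: "b < t \<or> \<rho> < s" for i t s
  proof -
    have q: "0 < \<kappa> / (T - t)" using ts \<kappa> by simp
    show ?thesis
    proof (cases "\<rho> < s")
      case True
      then have "Q - s - \<kappa> / (T - t) < m" using q unfolding \<rho>_def by linarith
      then show ?thesis using bnd[OF i ts] by linarith
    next
      case False
      then have "T - \<kappa> / \<rho> < t" using o by (auto simp: b_def)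
      then have "T - t < \<kappa> / \<rho>" by linarith
      then have "\<rho> < \<kappa> / (T - t)" using ts \<rho> by (simp add: field_simps)
      then have "Q - s - \<kappa> / (T - t) < m" using ts unfolding \<rho>_def by linarith
      then show ?thesis using bnd[OF i ts] by linarith
    qed
  qed
  define K where "K = {a..b} \<times> {0..\<rho>}"
  have "\<exists>z\<in>K. \<forall>y\<in>K. (\<lambda>(t, s). f i t s) y \<le> (\<lambda>(t, s). f i t s) z" if i: "i \<in> {1..N}" for i
  proof (rule upper_semicontinuous_attains_max)
    show "compact K" unfolding K_def by (intro compact_Times) auto
    show "K \<noteq> {}" unfolding K_def using b \<rho> by auto
    fix z :: "real \<times> real" and \<epsilon> :: real assume z: "z \<in> K" and \<epsilon>: "0 < \<epsilon>"
    obtain t s where ts: "z = (t, s)" by force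
    then have in_dom: "a \<le> t" "t < T" "0 \<le> s" using z b by (auto simp: K_def)
    obtain \<delta> where \<delta>: "\<delta> > 0" "\<forall>t' s'. a \<le> t' \<and> t' < T \<and> 0 \<le> s' \<and> \<bar>t' - t\<bar> < \<delta> \<and> \<bar>s' - s\<bar> < \<delta> \<longrightarrow>
        f i t' s' < f i t s + \<epsilon>" using usc[OF i in_dom \<epsilon>] by blast
    show "\<exists>\<delta>>0. \<forall>y\<in>K. dist y z < \<delta> \<longrightarrow> (case y of (t, s) \<Rightarrow> f i t s) < (case z of (t, s) \<Rightarrow> f i t s) + \<epsilon>"
    proof (intro exI[of _ \<delta>] conjI ballI impI)
      fix y assume y: "y \<in> K" "dist y z < \<delta>"
      have "\<bar>fst y - t\<bar> < \<delta>" "\<bar>snd y - s\<bar> < \<delta>"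
        using dist_fst_le[of y z] dist_snd_le[of y z] y ts by (auto simp: dist_real_def)
      then show "(case y of (t, s) \<Rightarrow> f i t s) < (case z of (t, s) \<Rightarrow> f i t s) + \<epsilon>"
        using \<delta>(2)[rule_format, of "fst y" "snd y"] y b ts by (auto simp: K_def case_prod_unfold)
    qed (use \<delta> in auto)
  qed
  then have "\<forall>i\<in>{1..N}. \<exists>z. z \<in> K \<and> (\<forall>y\<in>K. f i (fst y) (snd y) \<le> f i (fst z) (snd z))"
    by (simp add: case_prod_unfold Bex_def)
  from bchoice[OF this] obtain z where
    z: "\<forall>i\<in>{1..N}. z i \<in> K \<and> (\<forall>y\<in>K. f i (fst y) (snd y) \<le> f i (fst (z i)) (snd (z i)))" by blast
  define h where "h i = f i (fst (z i)) (snd (z i))" for i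
  have "Max (h ` {1..N}) \<in> h ` {1..N}" using N by (intro Max_in) auto
  then obtain k where k: "k \<in> {1..N}" "h k = Max (h ` {1..N})" by (metis imageE)
  have hk: "h i \<le> h k" if "i \<in> {1..N}" for i unfolding k(2) using that by (intro Max_ge) auto
  show thesis
  proof
    show "k \<in> {1..N}" by (rule k)
    have zk: "z k \<in> K" using z k by blast
    show "a \<le> fst (z k)" "fst (z k) < T" "0 \<le> snd (z k)"
      using zk b by (auto simp: K_def)
    fix i t' and s' :: real assume i: "i \<in> {1..N}" and ts: "a \<le> t'" "t' < T" "0 \<le> s'"
    have in_K: "f i t s \<le> h k" if "(t, s) \<in> K" for t s
    proof -
      have "f i t s \<le> h i" using z i that by (force simp: h_def)
      then show ?thesis using hk[OF i] by simp
    qed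
    have "f i t' s' \<le> h k"
    proof (cases "(t', s') \<in> K")
      case True then show ?thesis by (rule in_K)
    next
      case False
      then have "b < t' \<or> \<rho> < s'" using ts by (auto simp: K_def)
      then have "f i t' s' < f i a 0" using out[OF i ts] m[OF i] by linarith
      moreover have "(a, 0) \<in> K" using b \<rho> by (auto simp: K_def)
      ultimately show ?thesis using in_K by fastforce
    qed
    then show "f i t' s' \<le> f k (fst (z k)) (snd (z k))" by (simp add: h_def)
  qed
qed

text \<open>A partial derivative in \<open>t\<close> at the one point together with a continuous
  partial derivative in \<open>s\<close> gives total differentiability. Working within
  \<open>X \<times> Y\<close> covers the one-sided derivative at the vertex.\<close>

lemma has_derivative_two_variables:
  fixes f :: "real \<Rightarrow> real \<Rightarrow> real"
  assumes ft: "((\<lambda>t. f t s) has_real_derivative ft) (at t within X)"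
    and fs: "\<And>t s. t \<in> X \<Longrightarrow> s \<in> Y \<Longrightarrow> ((\<lambda>s. f t s) has_real_derivative fs t s) (at s within Y)"
    and cont: "continuous_on (X \<times> Y) (\<lambda>(t, s). fs t s)"
    and ts: "t \<in> X" "s \<in> Y" and Y: "convex Y"
  shows "((\<lambda>(t, s). f t s) has_derivative (\<lambda>(dt, ds). ft * dt + fs t s * ds)) (at (t, s) within X \<times> Y)"
proof -
  have "((\<lambda>(t, s). f t s) has_derivative (\<lambda>(dt, ds). ft * dt + blinfun_mult_right (fs t s) ds))
      (at (t, s) within X \<times> Y)"
  proof (rule has_derivative_partialsI)
    show "((\<lambda>t. f t s) has_derivative (\<lambda>dt. ft * dt)) (at t within X)"
      using ft by (simp add: has_field_derivative_def)
    show "((\<lambda>s. f t s) has_derivative blinfun_apply (blinfun_mult_right (fs t s))) (at s within Y)"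
      if "t \<in> X" "s \<in> Y" for t s
      using fs[OF that] by (simp add: has_field_derivative_def)
    have "continuous (at (t, s) within X \<times> Y) (\<lambda>z. blinfun_mult_right ((\<lambda>(t, s). fs t s) z))"
      using cont ts by (intro bounded_linear.continuous[OF bounded_linear_blinfun_mult_right])
        (auto simp: continuous_on_eq_continuous_within)
    then show "continuous (at (t, s) within X \<times> Y) (\<lambda>(t, s). blinfun_mult_right (fs t s))"
      by (simp add: case_prod_unfold)
  qed (use ts Y in auto)
  then show ?thesis by simp
qed

subsection \<open>Subsolutions along lines\<close>

text \<open>Subtracting \<open>\<gamma> / 2 * q^2\<close> leaves a convex function, so its tangent
  at 0 gives \<open>L i\<close> a quadratic lower bound; completing the square absorbs the linear
  terms.\<close>

lemma superlinear_of_A1: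
  assumes "A1 N L" "i \<in> {1..N}"
  shows "\<exists>R. \<forall>q. K * \<bar>q\<bar> - L i q \<le> R"
proof -
  obtain \<gamma> L1 L2 where \<gamma>: "\<gamma> > 0" and L1: "\<And>q. (L i has_real_derivative L1 q) (at q)"
    and L2: "\<And>q. (L1 has_real_derivative L2 q) (at q)" and L2\<gamma>: "\<And>q. L2 q \<ge> \<gamma>"
    using assms unfolding A1_def by blast
  define f where "f q = L i q - \<gamma> / 2 * q\<^sup>2" for q
  have f1: "(f has_real_derivative L1 q - \<gamma> * q) (at q)" for q
    unfolding f_def by (auto intro!: derivative_eq_intros L1)
  have "convex_on UNIV f"
    by (rule f''_ge0_imp_convex[where f' = "\<lambda>q. L1 q - \<gamma> * q" and f'' = "\<lambda>q. L2 q - \<gamma>"])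
      (auto intro!: derivative_eq_intros f1 L2 simp: L2\<gamma>)
  then have tan: "f q - f 0 \<ge> (L1 0 - \<gamma> * 0) * (q - 0)" for q
    by (rule convex_on_imp_above_tangent) (use f1[of 0] in auto)
  define a where "a = \<bar>K\<bar> + \<bar>L1 0\<bar>"
  have "K * \<bar>q\<bar> - L i q \<le> a\<^sup>2 / (2 * \<gamma>) - f 0" for q
  proof -
    have "L i q \<ge> f 0 + L1 0 * q + \<gamma> / 2 * q\<^sup>2" using tan[of q] by (simp add: f_def)
    moreover have "K * \<bar>q\<bar> - L1 0 * q \<le> a * \<bar>q\<bar>"
    proof -
      have "K * \<bar>q\<bar> \<le> \<bar>K\<bar> * \<bar>q\<bar>" by (intro mult_right_mono) auto
      moreover have "- (L1 0 * q) \<le> \<bar>L1 0\<bar> * \<bar>q\<bar>" by (metis abs_ge_minus_self abs_mult)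
      ultimately show ?thesis by (simp add: a_def algebra_simps)
    qed
    moreover have "a * \<bar>q\<bar> - \<gamma> / 2 * q\<^sup>2 \<le> a\<^sup>2 / (2 * \<gamma>)"
    proof -
      have "0 \<le> (\<gamma> * \<bar>q\<bar> - a)\<^sup>2 / (2 * \<gamma>)" using \<gamma> by simp
      also have "\<dots> = \<gamma> / 2 * q\<^sup>2 - a * \<bar>q\<bar> + a\<^sup>2 / (2 * \<gamma>)"
        using \<gamma> by (simp add: power2_diff field_simps power2_eq_square)
      finally show ?thesis by simp
    qed
    ultimately show ?thesis by linarith
  qed
  then show ?thesis by blast
qed

lemma bdd_above_legendre:
  assumes "A1 N L" "i \<in> {1..N}"
  shows "bdd_above ((\<lambda>q. p * q - L i q) ` Q)"
proof -
  obtain R where R: "\<And>q. \<bar>p\<bar> * \<bar>q\<bar> - L i q \<le> R" using superlinear_of_A1[OF assms] by blast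
  have "p * q - L i q \<le> R" for q
    using R[of q] abs_ge_self[of "p * q"] by (simp add: abs_mult)
  then show ?thesis by (auto simp: bdd_above_def)
qed

lemma Hi_ge: "A1 N L \<Longrightarrow> i \<in> {1..N} \<Longrightarrow> p * q - L i q \<le> Hi L i p"
  unfolding Hi_def by (rule cSUP_upper[OF UNIV_I bdd_above_legendre])

lemma Hi_minus_ge: "A1 N L \<Longrightarrow> i \<in> {1..N} \<Longrightarrow> q \<le> 0 \<Longrightarrow> p * q - L i q \<le> Hi_minus L i p"
  unfolding Hi_minus_def by (rule cSUP_upper[OF _ bdd_above_legendre]) (simp | assumption)+

lemma Hi_le: "(\<And>q. p * q - L i q \<le> c) \<Longrightarrow> Hi L i p \<le> c"
  unfolding Hi_def by (rule cSUP_least) simp_all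

lemma Hi_minus_le: "(\<And>q. q \<le> 0 \<Longrightarrow> p * q - L i q \<le> c) \<Longrightarrow> Hi_minus L i p \<le> c"
  unfolding Hi_minus_def by (rule cSUP_least) simp_all

lemma usc_add_continuous:
  fixes g \<phi> :: "real \<Rightarrow> real \<Rightarrow> real"
  assumes usc: "\<And>\<epsilon>. 0 < \<epsilon> \<Longrightarrow> \<exists>\<delta>>0. \<forall>t' s'. a \<le> t' \<and> t' < T \<and> 0 \<le> s' \<and> \<bar>t' - t\<bar> < \<delta> \<and> \<bar>s' - s\<bar> < \<delta> \<longrightarrow>
      g t' s' < g t s + \<epsilon>"
    and cont: "continuous_on ({a..<T} \<times> {0..}) (\<lambda>(t, s). \<phi> t s)"
    and ts: "a \<le> t" "t < T" "0 \<le> s" and \<epsilon>: "0 < \<epsilon>"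
  shows "\<exists>\<delta>>0. \<forall>t' s'. a \<le> t' \<and> t' < T \<and> 0 \<le> s' \<and> \<bar>t' - t\<bar> < \<delta> \<and> \<bar>s' - s\<bar> < \<delta> \<longrightarrow>
      g t' s' + \<phi> t' s' < g t s + \<phi> t s + \<epsilon>"
proof -
  obtain d where d: "d > 0" "\<forall>t' s'. a \<le> t' \<and> t' < T \<and> 0 \<le> s' \<and> \<bar>t' - t\<bar> < d \<and> \<bar>s' - s\<bar> < d \<longrightarrow>
      g t' s' < g t s + \<epsilon> / 2" using usc[of "\<epsilon> / 2"] \<epsilon> by auto
  obtain d' where d': "d' > 0" "\<forall>z\<in>{a..<T} \<times> {0..}. dist z (t, s) < d' \<longrightarrow>
      dist ((\<lambda>(t, s). \<phi> t s) z) (\<phi> t s) < \<epsilon> / 2"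
    using cont[unfolded continuous_on_iff, rule_format, of "(t, s)" "\<epsilon> / 2"] ts \<epsilon> by auto
  show ?thesis
  proof (intro exI[of _ "min d (d' / 2)"] conjI allI impI)
    fix t' s' assume A: "a \<le> t' \<and> t' < T \<and> 0 \<le> s' \<and> \<bar>t' - t\<bar> < min d (d' / 2) \<and> \<bar>s' - s\<bar> < min d (d' / 2)"
    have "dist (t', s') (t, s) \<le> dist t' t + dist s' s"
      unfolding dist_Pair_Pair by (rule order_trans[OF sqrt_sum_squares_le_sum]) auto
    also have "\<dots> < d'" using A by (auto simp: dist_real_def)
    finally have "\<bar>\<phi> t' s' - \<phi> t s\<bar> < \<epsilon> / 2" using d'(2)[rule_format, of "(t', s')"] A by (auto simp: dist_real_def)
    moreover have "g t' s' < g t s + \<epsilon> / 2" using d(2) A by auto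
    ultimately show "g t' s' + \<phi> t' s' < g t s + \<phi> t s + \<epsilon>" by linarith
  qed (use d d' in auto)
qed

section \<open>From viscosity inequalities to the inequality along lines\<close>

context
  fixes N :: nat and e :: "nat \<Rightarrow> real^2"
  assumes adm: "admissible_junction N e"
begin

lemma usc_J_branch:
  assumes "usc_J N e T u" "i \<in> {1..N}" "0 \<le> t" "t < T" "0 \<le> s" "0 < \<epsilon>"
  shows "\<exists>\<delta>>0. \<forall>t' s'. 0 \<le> t' \<and> t' < T \<and> 0 \<le> s' \<and> \<bar>t' - t\<bar> < \<delta> \<and> \<bar>s' - s\<bar> < \<delta> \<longrightarrow>
      u t' (s' *\<^sub>R e i) < u t (s *\<^sub>R e i) + \<epsilon>"
proof -
  obtain \<delta> where \<delta>: "\<delta> > 0" "\<forall>t'\<in>{0..<T}. \<forall>y\<in>junction N e. \<bar>t' - t\<bar> < \<delta> \<and> jdist N e (s *\<^sub>R e i) y < \<delta> \<longrightarrow>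
      u t' y < u t (s *\<^sub>R e i) + \<epsilon>"
    using assms(1)[unfolded usc_J_def, rule_format, of t "s *\<^sub>R e i" \<epsilon>] assms(3,4,6)
      scaleR_in_junction[OF assms(2) assms(5)] by auto
  show ?thesis
  proof (intro exI[of _ \<delta>] conjI allI impI)
    fix t' s' assume A: "0 \<le> t' \<and> t' < T \<and> 0 \<le> s' \<and> \<bar>t' - t\<bar> < \<delta> \<and> \<bar>s' - s\<bar> < \<delta>"
    then have "jdist N e (s *\<^sub>R e i) (s' *\<^sub>R e i) < \<delta>"
      using jdist_same_branch[OF adm assms(2) assms(5), of s'] by (simp add: abs_minus_commute)
    then show "u t' (s' *\<^sub>R e i) < u t (s *\<^sub>R e i) + \<epsilon>"
      using \<delta>(2)[rule_format, of t' "s' *\<^sub>R e i"] scaleR_in_junction[OF assms(2), of s'] A by simp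
  qed (rule \<delta>)
qed

lemma lsc_J_branch:
  assumes "lsc_J N e T v" "i \<in> {1..N}" "0 \<le> t" "t < T" "0 \<le> s" "0 < \<epsilon>"
  shows "\<exists>\<delta>>0. \<forall>t' s'. 0 \<le> t' \<and> t' < T \<and> 0 \<le> s' \<and> \<bar>t' - t\<bar> < \<delta> \<and> \<bar>s' - s\<bar> < \<delta> \<longrightarrow>
      - v t' (s' *\<^sub>R e i) < - v t (s *\<^sub>R e i) + \<epsilon>"
proof -
  have eq: "- a < - b + (\<epsilon>::real) \<longleftrightarrow> a > b - \<epsilon>" for a b \<epsilon> by auto
  have "usc_J N e T (\<lambda>t x. - v t x)"
    using assms(1) unfolding usc_J_def lsc_J_def eq .
  from usc_J_branch[OF this assms(2-6)] show ?thesis .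
qed

text \<open>The test function penalises the distance to the moving point
  \<open>x0 + q * (t - t0)\<close>. The penalty is transported at speed \<open>q\<close>, so it
  cancels in \<open>pt + q * px\<close>; by the affine bound \<open>p * q - L k q\<close> below the
  Hamiltonian, only the positive surplus from \<open>\<kappa>\<close> is left, which is absurd at a
  maximum.\<close>

lemma subsolution_line_estimate:
  assumes A1: "A1 N L" and sub: "subsolution N e L T u"
    and C: "0 < C" and growth: "\<And>t i s. 0 < t \<Longrightarrow> t < T \<Longrightarrow> i \<in> {1..N} \<Longrightarrow> 0 \<le> s \<Longrightarrow> u t (s *\<^sub>R e i) \<le> C * (1 + s)"
    and k: "k \<in> {1..N}" and t01: "0 < t0" "t0 < t1" "t1 < T" and x0: "0 < x0" and x1: "0 \<le> x0 + q * (t1 - t0)"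
  shows "u t1 ((x0 + q * (t1 - t0)) *\<^sub>R e k) \<le> u t0 (x0 *\<^sub>R e k) + (t1 - t0) * L k q"
proof (rule ccontr)
  define U0 where "U0 = u t0 (x0 *\<^sub>R e k)"
  define x1 where "x1 = x0 + q * (t1 - t0)"
  define D where "D = u t1 (x1 *\<^sub>R e k) - U0 - (t1 - t0) * L k q"
  assume "\<not> ?thesis"
  then have D: "0 < D" by (simp add: D_def U0_def x1_def)
  \<comment> \<open>At the end point the two corrections \<open>\<kappa> * (t1 - t0)\<close> and
    \<open>\<kappa> / (T - t1)\<close> together use up at most half of the defect
    \<open>D\<close>.\<close>
  define \<kappa> where "\<kappa> = D / (2 * (T + 1 / (T - t1)))"
  have den: "0 < T + 1 / (T - t1)" using t01 by (intro add_pos_pos) auto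
  have \<kappa>: "0 < \<kappa>" unfolding \<kappa>_def using D den by simp
  have \<kappa>D: "\<kappa> * T + \<kappa> / (T - t1) = D / 2"
  proof -
    have "\<kappa> * (T + 1 / (T - t1)) = D / 2" unfolding \<kappa>_def using den by (simp add: field_simps)
    then show ?thesis by (simp add: algebra_simps)
  qed
  define c where "c = L k q + \<kappa>"
  define m1 where "m1 = u t1 (x1 *\<^sub>R e k) - c * t1 - \<kappa> / (T - t1)"
  have m1: "U0 + D / 2 - c * t0 - \<kappa> / (T - t0) < m1"
  proof -
    have "m1 = U0 + D - c * t0 - \<kappa> * (t1 - t0) - \<kappa> / (T - t1)"
      unfolding m1_def D_def c_def by (simp add: algebra_simps)
    moreover have "\<kappa> * (t1 - t0) \<le> \<kappa> * T" using \<kappa> t01 by (intro mult_left_mono) auto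
    moreover have "0 < \<kappa> / (T - t0)" using \<kappa> t01 by simp
    ultimately show ?thesis using \<kappa>D by linarith
  qed
  have uscu: "usc_J N e T u" using sub by (simp add: subsolution_def)
  obtain \<delta> where \<delta>: "\<delta> > 0" "\<forall>t' s'. 0 \<le> t' \<and> t' < T \<and> 0 \<le> s' \<and> \<bar>t' - t0\<bar> < \<delta> \<and> \<bar>s' - x0\<bar> < \<delta> \<longrightarrow>
      u t' (s' *\<^sub>R e k) < U0 + D / 2"
    using usc_J_branch[OF uscu k, of t0 x0 "D / 2"] t01 x0 D unfolding U0_def by auto
  \<comment> \<open>The first summand makes the penalty coercive on branch \<open>k\<close>. The
    second lets it beat linear growth at time \<open>t0\<close> when \<open>s\<close> is at least
    \<open>\<delta>\<close> away from \<open>x0\<close>. The third does the same off branch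
    \<open>k\<close> at time \<open>t0\<close>, and at later times with \<open>q > 0\<close> at the
    vertex or off branch \<open>k\<close>, since there \<open>l t \<ge> x0\<close>.\<close>
  define n where "n = 1 + (C * \<delta> + \<bar>C * (1 + x0) - U0\<bar>) / \<delta>\<^sup>2 + (\<bar>C - U0\<bar> + \<bar>C + \<bar>c\<bar> * T - m1\<bar>) / x0\<^sup>2"
  have p1: "0 \<le> (C * \<delta> + \<bar>C * (1 + x0) - U0\<bar>) / \<delta>\<^sup>2" using C \<delta> by simp
  have p2: "0 \<le> (\<bar>C - U0\<bar> + \<bar>C + \<bar>c\<bar> * T - m1\<bar>) / x0\<^sup>2" by simp
  have n1: "1 \<le> n" using p1 p2 unfolding n_def by linarith
  have n2: "C * \<delta> + \<bar>C * (1 + x0) - U0\<bar> \<le> n * \<delta>\<^sup>2"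
  proof -
    have "(C * \<delta> + \<bar>C * (1 + x0) - U0\<bar>) / \<delta>\<^sup>2 \<le> n" using p2 unfolding n_def by linarith
    then show ?thesis using \<delta> by (simp add: pos_divide_le_eq)
  qed
  have n3: "\<bar>C - U0\<bar> + \<bar>C + \<bar>c\<bar> * T - m1\<bar> < n * x0\<^sup>2"
  proof -
    have "(\<bar>C - U0\<bar> + \<bar>C + \<bar>c\<bar> * T - m1\<bar>) / x0\<^sup>2 < n" using p1 unfolding n_def by linarith
    then show ?thesis using x0 by (simp add: pos_divide_less_eq)
  qed
  define \<Lambda> where "\<Lambda> = x0 + \<bar>q\<bar> * T"
  define l where "l t = x0 + q * (t - t0)" for t
  have l: "\<bar>l t\<bar> \<le> \<Lambda>" if "t0 \<le> t" "t < T" for t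
  proof -
    have "\<bar>q * (t - t0)\<bar> \<le> \<bar>q\<bar> * T" unfolding abs_mult using that t01 by (intro mult_left_mono) auto
    then show ?thesis unfolding l_def \<Lambda>_def using x0 by linarith
  qed
  define Lb where "Lb = (\<Sum>j\<in>{1..N}. \<bar>L j 1\<bar>)"
  have Lb: "L j 1 \<le> Lb" "0 \<le> Lb" if "j \<in> {1..N}" for j
  proof -
    have "\<bar>L j 1\<bar> \<le> Lb" unfolding Lb_def by (rule member_le_sum) (use that in auto)
    then show "L j 1 \<le> Lb" "0 \<le> Lb" by linarith+
  qed
  \<comment> \<open>Slope of the test function off branch \<open>k\<close>: above \<open>C\<close>
    for coercivity, and so steep that the single velocity 1 already contradicts the equation
    there.\<close>
  define B where "B = C + 1 + \<bar>c\<bar> + 2 * n * \<bar>q\<bar> * \<Lambda> + Lb"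
  have \<Lambda>0: "0 \<le> \<Lambda>" unfolding \<Lambda>_def using x0 t01 by simp
  have nq: "0 \<le> 2 * n * \<bar>q\<bar> * \<Lambda>" using n1 \<Lambda>0 by simp
  have BC: "C + 1 \<le> B" unfolding B_def using nq Lb[OF k] by linarith
  \<comment> \<open>Both cases give \<open>n * (l t)^2\<close> at \<open>s = 0\<close>, so the
    values match at the vertex although the slopes differ. After \<open>t1\<close> the point
    \<open>l t\<close> may have left the branch; the formula still makes sense.\<close>
  define \<phi> where "\<phi> i t s = c * t + \<kappa> / (T - t) + (if i = k then n * (s - l t)\<^sup>2 else n * (l t)\<^sup>2 + B * s)" for i t s
  define pt where "pt i t s = c + \<kappa> / (T - t)\<^sup>2 + (if i = k then - 2 * n * q * (s - l t) else 2 * n * q * l t)" for i :: nat and t s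
  define px where "px i t s = (if i = k then 2 * n * (s - l t) else B)" for i :: nat and t s
  have C1: "C1_branches N T \<phi> pt px"
    unfolding C1_branches_def
  proof (intro conjI ballI allI)
    fix i j t show "\<phi> i t 0 = \<phi> j t 0" by (simp add: \<phi>_def)
  next
    fix i
    have contl: "continuous_on A (\<lambda>z. l (fst z))" for A :: "(real \<times> real) set"
      unfolding l_def by (intro continuous_intros)
    show cx: "continuous_on ({0<..<T} \<times> {0..}) (\<lambda>(t, s). px i t s)"
      unfolding px_def case_prod_unfold
      by (cases "i = k") (auto intro!: continuous_intros contl)
    show "continuous_on ({0<..<T} \<times> {0..}) (\<lambda>(t, s). pt i t s)"
      unfolding pt_def case_prod_unfold
      by (cases "i = k") (auto intro!: continuous_intros contl)
    fix t s assume t: "t \<in> {0<..<T}" and s: "s \<in> {0::real..}"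
    show "((\<lambda>(t', s'). \<phi> i t' s') has_derivative (\<lambda>(dt, ds). pt i t s * dt + px i t s * ds))
       (at (t, s) within {0<..<T} \<times> {0..})"
    proof (rule has_derivative_two_variables[where ft = "pt i t s", OF _ _ cx])
      show "((\<lambda>t. \<phi> i t s) has_real_derivative pt i t s) (at t within {0<..<T})"
        unfolding \<phi>_def pt_def l_def using t
        by (cases "i = k") (auto intro!: derivative_eq_intros simp: power2_eq_square)
      show "((\<phi> i t) has_real_derivative px i t s) (at s within {0..})" for t s
        unfolding \<phi>_def px_def by (cases "i = k") (auto intro!: derivative_eq_intros)
    qed (use t s in auto)
  qed
  define f where "f i t s = u t (s *\<^sub>R e i) - \<phi> i t s" for i t s
  define Q where "Q = C + \<bar>c\<bar> * T + (C + 1) * \<Lambda> + (C + 1)\<^sup>2"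
  have cT: "- (\<bar>c\<bar> * T) \<le> c * t" if "t0 \<le> t" "t < T" for t
  proof -
    have "\<bar>c * t\<bar> \<le> \<bar>c\<bar> * T" unfolding abs_mult using that t01 by (intro mult_left_mono) auto
    then show ?thesis by linarith
  qed
  have bnd: "f i t s \<le> Q - s - \<kappa> / (T - t)" if i: "i \<in> {1..N}" and t: "t0 \<le> t" "t < T" and s: "0 \<le> s" for i t s
  proof -
    have u: "u t (s *\<^sub>R e i) \<le> C + C * s" using growth[of t i s] i t s t01 by (simp add: algebra_simps)
    have "C * s + s - (C + 1) * \<Lambda> - (C + 1)\<^sup>2 \<le> (if i = k then n * (s - l t)\<^sup>2 else n * (l t)\<^sup>2 + B * s)"
    proof (cases "i = k")
      case True
      have "0 \<le> (s - l t - (C + 1) / 2)\<^sup>2 + 3 / 4 * (C + 1)\<^sup>2" by simp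
      also have "\<dots> = (s - l t)\<^sup>2 - (C + 1) * (s - l t) + (C + 1)\<^sup>2"
        by (simp add: power2_eq_square field_simps)
      finally have "(C + 1) * (s - l t) - (C + 1)\<^sup>2 \<le> (s - l t)\<^sup>2" by linarith
      also have "\<dots> \<le> n * (s - l t)\<^sup>2" using n1 mult_right_mono[of 1 n "(s - l t)\<^sup>2"] by simp
      finally have "(C + 1) * s - (C + 1) * l t - (C + 1)\<^sup>2 \<le> n * (s - l t)\<^sup>2" by (simp add: algebra_simps)
      moreover have "(C + 1) * l t \<le> (C + 1) * \<Lambda>" using C l[OF t] by (intro mult_left_mono) auto
      ultimately show ?thesis using True by (simp add: algebra_simps)
    next
      case False
      have "(C + 1) * s \<le> B * s" using BC s by (intro mult_right_mono) auto
      moreover have "0 \<le> n * (l t)\<^sup>2" "0 \<le> (C + 1) * \<Lambda>" "0 \<le> (C + 1)\<^sup>2" using n1 C \<Lambda>0 by auto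
      moreover have "(C + 1) * s = C * s + s" by (simp add: algebra_simps)
      ultimately show ?thesis using False by (simp only: if_False)
    qed
    then show ?thesis unfolding f_def \<phi>_def Q_def using u cT[OF t] by linarith
  qed
  have contphi: "continuous_on ({t0..<T} \<times> {0..}) (\<lambda>(t, s). - \<phi> i t s)" for i
    unfolding \<phi>_def l_def case_prod_unfold
    by (cases "i = k") (auto intro!: continuous_intros)
  have uscf: "\<exists>\<delta>>0. \<forall>t' s'. t0 \<le> t' \<and> t' < T \<and> 0 \<le> s' \<and> \<bar>t' - t\<bar> < \<delta> \<and> \<bar>s' - s\<bar> < \<delta> \<longrightarrow> f i t' s' < f i t s + \<epsilon>"
    if i: "i \<in> {1..N}" and t: "t0 \<le> t" "t < T" and s: "0 \<le> s" and \<epsilon>: "0 < \<epsilon>" for i t s \<epsilon>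
  proof -
    have "\<exists>\<delta>>0. \<forall>t' s'. t0 \<le> t' \<and> t' < T \<and> 0 \<le> s' \<and> \<bar>t' - t\<bar> < \<delta> \<and> \<bar>s' - s\<bar> < \<delta> \<longrightarrow>
      u t' (s' *\<^sub>R e i) < u t (s *\<^sub>R e i) + \<epsilon>" if \<epsilon>: "0 < \<epsilon>" for \<epsilon>
    proof -
      obtain d where "d > 0" "\<forall>t' s'. 0 \<le> t' \<and> t' < T \<and> 0 \<le> s' \<and> \<bar>t' - t\<bar> < d \<and> \<bar>s' - s\<bar> < d \<longrightarrow>
        u t' (s' *\<^sub>R e i) < u t (s *\<^sub>R e i) + \<epsilon>"
        using usc_J_branch[OF uscu i _ t(2) s \<epsilon>] t t01 by auto
      then show ?thesis using t01 by (intro exI[of _ d]) auto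
    qed
    from usc_add_continuous[of t0 T t s "\<lambda>t s. u t (s *\<^sub>R e i)", OF this contphi[of i] t s \<epsilon>]
    show ?thesis by (simp add: f_def)
  qed
  have N1: "1 \<le> N" using adm by (simp add: admissible_junction_def)
  have t0T: "t0 < T" using t01 by simp
  obtain j t s where j: "j \<in> {1..N}" and t: "t0 \<le> t" "t < T" and s: "0 \<le> s"
    and max: "\<And>i t' s'. i \<in> {1..N} \<Longrightarrow> t0 \<le> t' \<Longrightarrow> t' < T \<Longrightarrow> 0 \<le> s' \<Longrightarrow> f i t' s' \<le> f j t s"
    by (rule coercive_usc_attains_max[OF N1 t0T \<kappa> uscf bnd]) (assumption | blast)+
  have "f k t1 x1 = m1" unfolding f_def \<phi>_def m1_def l_def x1_def by simp
  moreover have "0 \<le> x1" using x1 by (simp add: x1_def)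
  ultimately have fm: "m1 \<le> f j t s" using max[OF k, of t1 x1] t01 by simp
  \<comment> \<open>At time \<open>t0\<close>, near \<open>x0\<close> upper semicontinuity bounds
    \<open>u\<close> by \<open>U0 + D / 2\<close>, and elsewhere the penalty compensates for the
    growth of \<open>u\<close>; the value \<open>m1\<close> at the end point is larger.\<close>
  have "t \<noteq> t0"
  proof
    assume tt: "t = t0"
    have "u t0 (s *\<^sub>R e j) - (if j = k then n * (s - x0)\<^sup>2 else n * x0\<^sup>2 + B * s) < U0 + D / 2"
    proof (cases "j = k")
      case True
      show ?thesis
      proof (cases "\<bar>s - x0\<bar> < \<delta>")
        case close: True
        have "0 \<le> n * (s - x0)\<^sup>2" using n1 by simp
        moreover have "u t0 (s *\<^sub>R e k) < U0 + D / 2" using \<delta> close t01 s by auto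
        ultimately show ?thesis using True by simp
      next
        case far: False
        define y where "y = \<bar>s - x0\<bar>"
        have y: "\<delta> \<le> y" "0 < y" using far \<delta> by (auto simp: y_def)
        have "u t0 (s *\<^sub>R e k) \<le> C * (1 + s)" using growth[of t0 k s] k s t01 by simp
        also have "\<dots> \<le> C * (1 + x0 + y)" using C unfolding y_def by (intro mult_left_mono) auto
        finally have a: "u t0 (s *\<^sub>R e k) \<le> C * (1 + x0) + C * y" by (simp add: algebra_simps)
        have "C * y * \<delta> + \<bar>C * (1 + x0) - U0\<bar> * \<delta> \<le> C * y * \<delta> + \<bar>C * (1 + x0) - U0\<bar> * y"
          using y by (intro add_left_mono mult_left_mono) auto
        also have "\<dots> = (C * \<delta> + \<bar>C * (1 + x0) - U0\<bar>) * y" by (simp add: algebra_simps)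
        also have "\<dots> \<le> n * \<delta>\<^sup>2 * y" using n2 y by (intro mult_right_mono) auto
        also have "\<dots> = n * (\<delta> * y) * \<delta>" by (simp add: power2_eq_square)
        also have "\<dots> \<le> n * (y * y) * \<delta>" using n1 y \<delta> by (intro mult_right_mono mult_left_mono) auto
        finally have "(C * y + \<bar>C * (1 + x0) - U0\<bar>) * \<delta> \<le> (n * y\<^sup>2) * \<delta>" by (simp add: algebra_simps power2_eq_square)
        then have "C * y + \<bar>C * (1 + x0) - U0\<bar> \<le> n * y\<^sup>2" using \<delta>(1) by (rule mult_right_le_imp_le)
        then have "C * (1 + x0) + C * y - n * (s - x0)\<^sup>2 \<le> U0" by (simp add: y_def)
        then show ?thesis using a D True by simp
      qed
    next
      case False
      have "u t0 (s *\<^sub>R e j) \<le> C + C * s" using growth[of t0 j s] j s t01 by (simp add: algebra_simps)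
      moreover have "C * s \<le> B * s" using BC s by (intro mult_right_mono) auto
      ultimately show ?thesis using False n3 D by simp
    qed
    then have "f j t s < U0 + D / 2 - c * t0 - \<kappa> / (T - t0)"
      unfolding f_def \<phi>_def tt l_def by (auto split: if_splits)
    then show False using fm m1 by linarith
  qed
  then have t': "t0 < t" "0 < t" using t t01 by auto
  have pos: "0 < \<kappa> / (T - t)\<^sup>2" using t \<kappa> by simp
  \<comment> \<open>For \<open>q > 0\<close> the moving point recedes from the vertex, so a maximum
    at the vertex or off branch \<open>k\<close> would pay at least \<open>n * x0^2\<close>. At the
    vertex this leaves the velocities \<open>q \<le> 0\<close>, those that \<open>Hi_minus\<close>
    controls.\<close>
  have out: "\<not> (0 < q \<and> (s = 0 \<or> j \<noteq> k))"
  proof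
    assume A: "0 < q \<and> (s = 0 \<or> j \<noteq> k)"
    have "x0 \<le> l t" unfolding l_def using A t by simp
    then have "n * x0\<^sup>2 \<le> n * (l t)\<^sup>2" using n1 x0 by (intro mult_left_mono power_mono) auto
    moreover have "C * s \<le> B * s" using BC s by (intro mult_right_mono) auto
    moreover have "u t (s *\<^sub>R e j) \<le> C + C * s" using growth[of t j s] j s t t' by (simp add: algebra_simps)
    moreover have "0 < \<kappa> / (T - t)" using t \<kappa> by simp
    moreover have "f j t s \<le> u t (s *\<^sub>R e j) - c * t - \<kappa> / (T - t) - n * (l t)\<^sup>2 - B * s"
      using A unfolding f_def \<phi>_def by (cases "j = k") auto
    ultimately have "f j t s < m1" using n3 cT[OF t] by linarith
    then show False using fm by simp
  qed
  \<comment> \<open>The radius \<open>t - t0\<close> keeps the neighbourhood at times after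
    \<open>t0\<close>, where maximality is known.\<close>
  have mx: "u t' (s' *\<^sub>R e i) - \<phi> i t' s' \<le> u t (s *\<^sub>R e j) - \<phi> j t s"
    if "i \<in> {1..N}" "0 < t'" "t' < T" "\<bar>t' - t\<bar> < t - t0" "0 \<le> s'" for i t' s'
    using max[of i t' s'] that by (auto simp: f_def)
  show False
  proof (cases "s = 0")
    case True
    then have "q \<le> 0" using out by auto
    have "pt 1 t 0 + Hi_minus L k (px k t 0) \<le> 0"
      by (rule subsolution_test(2)[OF adm sub C1 j t'(2) t(2) s _ mx True k]) (use t' in auto)
    moreover have "px k t 0 * q - L k q \<le> Hi_minus L k (px k t 0)"
      by (rule Hi_minus_ge[OF A1 k \<open>q \<le> 0\<close>])
    ultimately show False using pos \<kappa> unfolding pt_def px_def c_def by (auto simp: algebra_simps split: if_splits)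
  next
    case False
    then have "pt j t s + Hi L j (px j t s) \<le> 0"
      by (intro subsolution_test(1)[OF adm sub C1 j t'(2) t(2) s _ mx]) (use t' s in auto)
    show False
    proof (cases "j = k")
      case True
      have "px k t s * q - L k q \<le> Hi L k (px k t s)" by (rule Hi_ge[OF A1 k])
      then show False using \<open>pt j t s + Hi L j (px j t s) \<le> 0\<close> True pos \<kappa>
        unfolding pt_def px_def c_def by (simp add: algebra_simps)
    next
      case jk: False
      have "px j t s * 1 - L j 1 \<le> Hi L j (px j t s)" by (rule Hi_ge[OF A1 j])
      then have "pt j t s + B - L j 1 \<le> 0" using \<open>pt j t s + Hi L j (px j t s) \<le> 0\<close> jk by (simp add: px_def)
      moreover have "- (2 * n * \<bar>q\<bar> * \<Lambda>) \<le> 2 * n * q * l t"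
      proof -
        have "\<bar>2 * n * q * l t\<bar> = 2 * n * \<bar>q\<bar> * \<bar>l t\<bar>" using n1 by (simp add: abs_mult)
        also have "\<dots> \<le> 2 * n * \<bar>q\<bar> * \<Lambda>" using n1 l[OF t] by (intro mult_left_mono) auto
        finally show ?thesis by linarith
      qed
      moreover have "pt j t s = c + \<kappa> / (T - t)\<^sup>2 + 2 * n * q * l t" using jk by (simp add: pt_def)
      ultimately show False using pos Lb[OF j] C unfolding B_def by linarith
    qed
  qed
qed

end

text \<open>Lines starting at the vertex or at time 0 are obtained by a limit. The start moves to
  \<open>(t + d, x + d)\<close>, where \<open>u\<close> is at most slightly larger by upper
  semicontinuity, the end stays fixed, and the velocity varies continuously with
  \<open>d\<close>.\<close>

lemma subsolution_estimate:
  assumes adm: "admissible_junction N e" and A1: "A1 N L" and sub: "subsolution N e L T u"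
    and C: "0 < C" and growth: "\<And>t i s. 0 < t \<Longrightarrow> t < T \<Longrightarrow> i \<in> {1..N} \<Longrightarrow> 0 \<le> s \<Longrightarrow> u t (s *\<^sub>R e i) \<le> C * (1 + s)"
    and k: "k \<in> {1..N}" and t: "0 \<le> t" "0 < h" "t + h < T" and x: "0 \<le> x" "0 \<le> y"
  shows "u (t + h) (y *\<^sub>R e k) \<le> u t (x *\<^sub>R e k) + h * L k ((y - x) / h)"
proof (rule field_le_epsilon)
  fix \<epsilon> :: real assume \<epsilon>: "0 < \<epsilon>"
  define r where "r d = (h - d) * L k ((y - x - d) / (h - d))" for d
  have "isCont (L k) q" for q
    using A1 k unfolding A1_def by (metis DERIV_isCont)
  moreover have "isCont (\<lambda>d. (y - x - d) / (h - d)) 0" using t by (auto intro!: continuous_intros)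
  ultimately have "isCont (\<lambda>d. L k ((y - x - d) / (h - d))) 0" by (rule isCont_o2[rotated])
  then have "isCont r 0" unfolding r_def by (intro continuous_intros)
  then obtain d1 where d1: "d1 > 0" "\<And>d. \<bar>d\<bar> < d1 \<Longrightarrow> \<bar>r d - r 0\<bar> < \<epsilon> / 2"
    unfolding continuous_at_eps_delta using \<epsilon> by (metis diff_zero dist_real_def half_gt_zero)
  have "usc_J N e T u" using sub by (simp add: subsolution_def)
  then obtain d2 where d2: "d2 > 0" "\<forall>t' s'. 0 \<le> t' \<and> t' < T \<and> 0 \<le> s' \<and> \<bar>t' - t\<bar> < d2 \<and> \<bar>s' - x\<bar> < d2 \<longrightarrow>
      u t' (s' *\<^sub>R e k) < u t (x *\<^sub>R e k) + \<epsilon> / 2"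
    using usc_J_branch[OF adm _ k, of T u t x "\<epsilon> / 2"] t x \<epsilon> by auto
  define d where "d = min (h / 2) (min (d1 / 2) (d2 / 2))"
  have d: "0 < d" "d < h" "d < d1" "d < d2" using t d1 d2 by (auto simp: d_def)
  have "u (t + h) (((x + d) + (y - x - d) / (h - d) * (t + h - (t + d))) *\<^sub>R e k)
      \<le> u (t + d) ((x + d) *\<^sub>R e k) + (t + h - (t + d)) * L k ((y - x - d) / (h - d))"
    by (rule subsolution_line_estimate[OF adm A1 sub C growth k]) (use d t x in auto)
  moreover have "(x + d) + (y - x - d) / (h - d) * (t + h - (t + d)) = y" using d by (simp add: field_simps)
  moreover have "(t + h - (t + d)) * L k ((y - x - d) / (h - d)) = r d" by (simp add: r_def)
  moreover have "r 0 = h * L k ((y - x) / h)" by (simp add: r_def)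
  moreover have "u (t + d) ((x + d) *\<^sub>R e k) < u t (x *\<^sub>R e k) + \<epsilon> / 2"
    using d2(2)[rule_format, of "t + d" "x + d"] d t x by simp
  moreover have "\<bar>r d - r 0\<bar> < \<epsilon> / 2" using d1(2)[of d] d by simp
  ultimately show "u (t + h) (y *\<^sub>R e k) \<le> u t (x *\<^sub>R e k) + h * L k ((y - x) / h) + \<epsilon>"
    by (simp only:)
qed

section \<open>Running supremum in time\<close>

text \<open>The times \<open>\<tau>\<close> have no lower bound, so shifting them back by
  \<open>h\<close> stays in the index set. For \<open>t \<ge> T\<close> the value no longer depends
  on \<open>t\<close>.\<close>

definition running_sup :: "real \<Rightarrow> (real \<Rightarrow> real \<Rightarrow> real) \<Rightarrow> real \<Rightarrow> real \<Rightarrow> real" where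
  "running_sup T E t s = (SUP \<tau>\<in>{\<tau>. \<tau> \<le> t \<and> \<tau> < T}. E \<tau> s)"

lemma running_sup_upper:
  assumes "\<And>\<tau>. \<tau> < T \<Longrightarrow> E \<tau> s \<le> B" "\<tau> \<le> t" "\<tau> < T"
  shows "E \<tau> s \<le> running_sup T E t s"
  unfolding running_sup_def
  by (rule cSUP_upper) (use assms in \<open>auto simp: bdd_above_def\<close>)

lemma running_sup_least:
  assumes "\<And>\<tau>. \<tau> \<le> t \<Longrightarrow> \<tau> < T \<Longrightarrow> E \<tau> s \<le> c"
  shows "running_sup T E t s \<le> c"
proof -
  have "min t (T - 1) \<in> {\<tau>. \<tau> \<le> t \<and> \<tau> < T}" by auto
  then have "{\<tau>. \<tau> \<le> t \<and> \<tau> < T} \<noteq> {}" by blast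
  then show ?thesis unfolding running_sup_def using assms by (rule cSUP_least) auto
qed

lemma running_sup_mono:
  assumes "\<And>\<tau>. \<tau> < T \<Longrightarrow> E \<tau> s \<le> B" "t \<le> t'"
  shows "running_sup T E t s \<le> running_sup T E t' s"
  by (rule running_sup_least, rule running_sup_upper[where B = B]) (use assms in auto)

context
  fixes T :: real and E :: "real \<Rightarrow> real \<Rightarrow> real" and b l :: "real \<Rightarrow> real"
  assumes ub: "\<And>\<tau> s. \<tau> < T \<Longrightarrow> 0 \<le> s \<Longrightarrow> E \<tau> s \<le> b s"
    and est: "\<And>\<tau> h x y. 0 < h \<Longrightarrow> \<tau> + h < T \<Longrightarrow> 0 \<le> x \<Longrightarrow> 0 \<le> y \<Longrightarrow> E (\<tau> + h) y \<le> E \<tau> x + h * l ((y - x) / h)"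
begin

text \<open>Each \<open>\<tau> \<le> t + h\<close> is compared with
  \<open>\<tau> - h \<le> t\<close>. As only \<open>\<tau> < T\<close> occurs in the supremum, the
  estimate holds for all times \<open>t\<close>.\<close>

lemma running_sup_estimate:
  assumes "0 < h" "0 \<le> x" "0 \<le> y"
  shows "running_sup T E (t + h) y \<le> running_sup T E t x + h * l ((y - x) / h)"
proof (rule running_sup_least)
  fix \<tau> assume \<tau>: "\<tau> \<le> t + h" "\<tau> < T"
  have "E \<tau> y \<le> E (\<tau> - h) x + h * l ((y - x) / h)" using est[of h "\<tau> - h" x y] assms \<tau> by simp
  moreover have "E (\<tau> - h) x \<le> running_sup T E t x" by (rule running_sup_upper[where B = "b x"]) (use ub assms \<tau> in auto)
  ultimately show "E \<tau> y \<le> running_sup T E t x + h * l ((y - x) / h)" by simp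
qed

text \<open>Moving from \<open>x\<close> to \<open>y\<close> at speed 1 or -1 takes time
  \<open>|x - y|\<close>, which monotonicity in \<open>t\<close> gives back. Velocity 0 bounds the
  growth in time.\<close>

lemma running_sup_Lipschitz:
  assumes \<Lambda>: "l 0 \<le> \<Lambda>" "l 1 \<le> \<Lambda>" "l (-1) \<le> \<Lambda>" and x: "0 \<le> x" "0 \<le> y"
  shows "\<bar>running_sup T E t x - running_sup T E t' y\<bar> \<le> \<Lambda> * (\<bar>t - t'\<bar> + \<bar>x - y\<bar>)"
proof -
  let ?S = "running_sup T E"
  have space: "?S t y \<le> ?S t x + \<Lambda> * \<bar>x - y\<bar>" if "0 \<le> x" "0 \<le> y" for t x y
  proof (cases "x = y")
    case False
    define h where "h = \<bar>x - y\<bar>"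
    have h: "0 < h" using False by (simp add: h_def)
    have "(y - x) / h = 1 \<or> (y - x) / h = -1" using False by (auto simp: h_def abs_if field_simps)
    then have l: "h * l ((y - x) / h) \<le> h * \<Lambda>" using h \<Lambda> by (intro mult_left_mono) auto
    have "?S t y \<le> ?S (t - h) x + h * l ((y - x) / h)"
      using running_sup_estimate[of h x y "t - h"] h that by simp
    moreover have "?S (t - h) x \<le> ?S t x" by (rule running_sup_mono[where B = "b x"]) (use ub h that in auto)
    ultimately show ?thesis using l by (simp add: h_def mult.commute)
  qed simp
  have time: "?S t' x \<le> ?S t x + \<Lambda> * \<bar>t - t'\<bar>" if "t \<le> t'" "0 \<le> x" for t t' x
  proof (cases "t = t'")
    case False
    then have "?S t' x \<le> ?S t x + (t' - t) * l 0"
      using running_sup_estimate[of "t' - t" x x t] that by simp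
    also have "(t' - t) * l 0 \<le> (t' - t) * \<Lambda>" using that \<Lambda> by (intro mult_left_mono) auto
    finally show ?thesis using that by (simp add: mult.commute)
  qed simp
  have mono: "?S t x \<le> ?S t' x" if "t \<le> t'" for t t'
    by (rule running_sup_mono[where B = "b x"]) (use ub x that in auto)
  have "\<bar>?S t x - ?S t' x\<bar> \<le> \<Lambda> * \<bar>t - t'\<bar>"
  proof (cases "t \<le> t'")
    case True
    then show ?thesis using time[OF True x(1)] mono[OF True] by linarith
  next
    case False
    then have "t' \<le> t" by simp
    then show ?thesis using time[OF _ x(1), of t' t] mono[of t' t]
      by (simp add: abs_minus_commute) 
  qed
  moreover have "\<bar>?S t' x - ?S t' y\<bar> \<le> \<Lambda> * \<bar>x - y\<bar>"
    using space[of x y t'] space[of y x t'] x by (simp add: abs_minus_commute abs_le_iff)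
  ultimately show ?thesis by (simp add: distrib_left) 
qed

end

subsection \<open>Averaging\<close>

text \<open>The average looks to the right only: applied to the space coordinate, it looks away from
  the vertex.\<close>

definition window :: "real \<Rightarrow> (real \<Rightarrow> real) \<Rightarrow> real \<Rightarrow> real" where
  "window \<epsilon> h t = integral {0..\<epsilon>} (\<lambda>a. h (t + a)) / \<epsilon>"

lemma continuous_on_shift:
  fixes h :: "real \<Rightarrow> real"
  assumes "continuous_on UNIV h"
  shows "continuous_on A (\<lambda>a. h (t + a))"
  by (rule continuous_on_compose2[OF assms]) (auto intro!: continuous_intros)

lemma window_const:
  assumes "0 < \<epsilon>"
  shows "window \<epsilon> (\<lambda>_. c) t = c"
  using assms by (simp add: window_def)

lemma window_le:
  assumes "0 < \<epsilon>" "continuous_on UNIV h" "continuous_on UNIV g"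
    and "\<And>a. 0 \<le> a \<Longrightarrow> a \<le> \<epsilon> \<Longrightarrow> h (t' + a) \<le> g (t + a) + c"
  shows "window \<epsilon> h t' \<le> window \<epsilon> g t + c"
proof -
  have h: "(\<lambda>a. h (t' + a)) integrable_on {0..\<epsilon>}" and g: "(\<lambda>a. g (t + a)) integrable_on {0..\<epsilon>}"
    by (rule integrable_continuous_real, rule continuous_on_shift, fact)+
  have "integral {0..\<epsilon>} (\<lambda>a. h (t' + a)) \<le> integral {0..\<epsilon>} (\<lambda>a. g (t + a) + c)"
    by (rule integral_le) (use h g assms in \<open>auto intro!: integrable_add\<close>)
  also have "\<dots> = integral {0..\<epsilon>} (\<lambda>a. g (t + a)) + \<epsilon> * c"
    using g assms(1) by (subst integral_add) auto
  finally show ?thesis using assms(1) by (simp add: window_def field_simps)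
qed

lemma window_close:
  assumes \<epsilon>: "0 < \<epsilon>" and h: "continuous_on UNIV h"
    and "\<And>a. 0 \<le> a \<Longrightarrow> a \<le> \<epsilon> \<Longrightarrow> \<bar>h (t + a) - c\<bar> \<le> d"
  shows "\<bar>window \<epsilon> h t - c\<bar> \<le> d"
proof -
  have "h (t + a) \<le> c + d" "c \<le> h (t + a) + d" if "0 \<le> a" "a \<le> \<epsilon>" for a
    using assms(3)[OF that] by linarith+
  then have "window \<epsilon> h t \<le> window \<epsilon> (\<lambda>_. c) t + d" "window \<epsilon> (\<lambda>_. c) t \<le> window \<epsilon> h t + d"
    using \<epsilon> h by (auto intro!: window_le)
  then show ?thesis using window_const[OF \<epsilon>, of c t] by linarith
qed

lemma continuous_on_window_param:
  fixes k :: "'a::topological_space \<Rightarrow> real \<Rightarrow> real"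
  assumes "continuous_on UNIV (\<lambda>(z, a). k z a)"
  shows "continuous_on UNIV (\<lambda>z. integral {0..\<epsilon>} (k z) / \<epsilon>)"
proof -
  have "continuous_on UNIV (\<lambda>z. integral (cbox 0 \<epsilon>) (k z))"
    by (rule integral_continuous_on_param, rule continuous_on_subset[OF assms]) simp
  then show ?thesis by (auto simp: divide_inverse intro!: continuous_intros)
qed

text \<open>By the fundamental theorem the derivative is a difference quotient of \<open>h\<close>,
  so continuity of \<open>h\<close> already makes the average continuously differentiable.\<close>

lemma window_has_derivative:
  assumes \<epsilon>: "0 < \<epsilon>" and h: "continuous_on UNIV h"
  shows "(window \<epsilon> h has_real_derivative (h (t + \<epsilon>) - h t) / \<epsilon>) (at t)"
proof -
  define c where "c = t - 1"
  define F where "F y = integral {c..y} h" for y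
  have hc: "continuous_on A h" for A using continuous_on_subset[OF h] by blast
  have F: "(F has_real_derivative h y) (at y)" if "c < y" for y
  proof -
    have "(F has_real_derivative h y) (at y within {c..y + 1})"
      unfolding F_def by (rule integral_has_real_derivative) (use that hc in auto)
    then show ?thesis using that by (simp add: at_within_Icc_at)
  qed
  have F': "((\<lambda>x. F (x + \<epsilon>)) has_real_derivative h (t + \<epsilon>)) (at t)"
    using F[of "t + \<epsilon>"] \<epsilon> by (simp add: DERIV_shift c_def)
  have D: "((\<lambda>x. (F (x + \<epsilon>) - F x) / \<epsilon>) has_real_derivative (h (t + \<epsilon>) - h t) / \<epsilon>) (at t)"
    by (intro DERIV_cdivide DERIV_diff F' F) (simp add: c_def)
  have eq: "(F (x + \<epsilon>) - F x) / \<epsilon> = window \<epsilon> h x" if "c < x" for x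
  proof -
    have "integral {0..\<epsilon>} (\<lambda>a. h (x + a)) = integral {x..x + \<epsilon>} h"
      using integral_shift_Icc_real[of 0 \<epsilon> h x] by (simp add: o_def add.commute)
    moreover have "F x + integral {x..x + \<epsilon>} h = F (x + \<epsilon>)"
      unfolding F_def by (rule Henstock_Kurzweil_Integration.integral_combine)
        (use that \<epsilon> hc in \<open>auto intro!: integrable_continuous_real\<close>)
    ultimately show ?thesis by (simp add: window_def)
  qed
  have "t \<in> {c<..}" by (simp add: c_def)
  from has_field_derivative_transform_within_open[OF D open_greaterThan this] eq show ?thesis by simp
qed

text \<open>Otherwise \<open>f (t - h) (x - q * h) + h * c\<close> has negative derivative at
  \<open>h = 0\<close> and drops below \<open>f t x\<close>. Following the line backwards is what
  makes \<open>q \<le> 0\<close> admissible at the vertex.\<close>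

lemma derivative_along_line_le:
  fixes f :: "real \<Rightarrow> real \<Rightarrow> real"
  assumes f: "((\<lambda>(t, s). f t s) has_derivative (\<lambda>(dt, ds). a * dt + b * ds)) (at (t, x))"
    and h0: "0 < h0" and le: "\<And>h. 0 < h \<Longrightarrow> h < h0 \<Longrightarrow> f t x \<le> f (t - h) (x - q * h) + h * c"
  shows "a + q * b \<le> c"
proof (rule ccontr)
  assume neg: "\<not> ?thesis"
  have line: "((\<lambda>h. (t - h, x - q * h)) has_derivative (\<lambda>d. (- d, - q * d))) (at 0)"
    by (auto intro!: derivative_eq_intros)
  have "((\<lambda>(t, s). f t s) has_derivative (\<lambda>(dt, ds). a * dt + b * ds)) (at (t - 0, x - q * 0))"
    using f by simp
  from has_derivative_compose[OF line this]
  have "((\<lambda>h. f (t - h) (x - q * h)) has_derivative (\<lambda>d. a * (- d) + b * (- q * d))) (at 0)"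
    by (simp only: prod.case)
  then have "((\<lambda>h. f (t - h) (x - q * h)) has_real_derivative - (a + q * b)) (at 0)"
    unfolding has_field_derivative_def by (rule has_derivative_eq_rhs) (auto simp: fun_eq_iff algebra_simps)
  then have "((\<lambda>h. f (t - h) (x - q * h) + h * c) has_real_derivative c - (a + q * b)) (at 0)"
    by (auto intro!: derivative_eq_intros)
  from DERIV_neg_dec_right[OF this] neg obtain d where
    d: "d > 0" "\<forall>h>0. 0 + h \<in> UNIV \<longrightarrow> h < d \<longrightarrow> f (t - (0 + h)) (x - q * (0 + h)) + (0 + h) * c < f (t - 0) (x - q * 0) + 0 * c"
    by auto
  define h where "h = min d h0 / 2"
  have "0 < h" "h < d" "h < h0" using d h0 by (auto simp: h_def)
  then show False using d(2) le[of h] by fastforce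
qed

section \<open>Space-time averages and the correction at the vertex\<close>

definition mean2 :: "real \<Rightarrow> real \<Rightarrow> (real \<Rightarrow> real \<Rightarrow> real) \<Rightarrow> real \<Rightarrow> real \<Rightarrow> real" where
  "mean2 \<epsilon> \<delta> S t x = window \<epsilon> (\<lambda>t. window \<delta> (\<lambda>x. S t (max 0 x)) x) t"

text \<open>The values at \<open>x = 0\<close> of \<open>mean2\<close> on different branches differ; \<open>smooth\<close> replaces them by the time
  average of the common vertex value. Clamping \<open>x\<close> at 0 only serves to have functions on the whole line.\<close>
definition smooth :: "real \<Rightarrow> real \<Rightarrow> (real \<Rightarrow> real \<Rightarrow> real) \<Rightarrow> real \<Rightarrow> real \<Rightarrow> real" where
  "smooth \<epsilon> \<delta> S t x = mean2 \<epsilon> \<delta> S t x - mean2 \<epsilon> \<delta> S t 0 + window \<epsilon> (\<lambda>t. S t 0) t"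

definition mean2_t :: "real \<Rightarrow> real \<Rightarrow> (real \<Rightarrow> real \<Rightarrow> real) \<Rightarrow> real \<Rightarrow> real \<Rightarrow> real" where
  "mean2_t \<epsilon> \<delta> S t x = (window \<delta> (\<lambda>x. S (t + \<epsilon>) (max 0 x)) x - window \<delta> (\<lambda>x. S t (max 0 x)) x) / \<epsilon>"

definition smooth_t :: "real \<Rightarrow> real \<Rightarrow> (real \<Rightarrow> real \<Rightarrow> real) \<Rightarrow> real \<Rightarrow> real \<Rightarrow> real" where
  "smooth_t \<epsilon> \<delta> S t x = mean2_t \<epsilon> \<delta> S t x - mean2_t \<epsilon> \<delta> S t 0 + (S (t + \<epsilon>) 0 - S t 0) / \<epsilon>"

text \<open>Space derivative of \<open>mean2\<close> and of \<open>smooth\<close> alike, since these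
  differ by a function of \<open>t\<close>.\<close>

definition smooth_x :: "real \<Rightarrow> real \<Rightarrow> (real \<Rightarrow> real \<Rightarrow> real) \<Rightarrow> real \<Rightarrow> real \<Rightarrow> real" where
  "smooth_x \<epsilon> \<delta> S t x = window \<epsilon> (\<lambda>t. (S t (max 0 (x + \<delta>)) - S t (max 0 x)) / \<delta>) t"

context
  fixes \<epsilon> \<delta> \<Lambda> :: real and S :: "real \<Rightarrow> real \<Rightarrow> real"
  assumes \<epsilon>: "0 < \<epsilon>" and \<delta>: "0 < \<delta>" and \<Lambda>: "0 \<le> \<Lambda>"
    and Lip: "\<And>t t' x y. 0 \<le> x \<Longrightarrow> 0 \<le> y \<Longrightarrow> \<bar>S t x - S t' y\<bar> \<le> \<Lambda> * (\<bar>t - t'\<bar> + \<bar>x - y\<bar>)"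
begin

lemma continuous_S: "continuous_on UNIV (\<lambda>z. S (fst z) (max 0 (snd z)))"
proof (rule continuous_on_iff[THEN iffD2], intro ballI allI impI)
  fix z :: "real \<times> real" and \<eta> :: real assume \<eta>: "0 < \<eta>"
  show "\<exists>d>0. \<forall>z'\<in>UNIV. dist z' z < d \<longrightarrow> dist (S (fst z') (max 0 (snd z'))) (S (fst z) (max 0 (snd z))) < \<eta>"
  proof (intro exI[of _ "\<eta> / (2 * \<Lambda> + 1)"] conjI ballI impI)
    show "0 < \<eta> / (2 * \<Lambda> + 1)" using \<eta> \<Lambda> by simp
    fix z' :: "real \<times> real" assume z': "dist z' z < \<eta> / (2 * \<Lambda> + 1)"
    have "\<bar>S (fst z') (max 0 (snd z')) - S (fst z) (max 0 (snd z))\<bar>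
        \<le> \<Lambda> * (\<bar>fst z' - fst z\<bar> + \<bar>max 0 (snd z') - max 0 (snd z)\<bar>)" by (rule Lip) auto
    also have "\<dots> \<le> \<Lambda> * (dist z' z + dist z' z)"
    proof (intro mult_left_mono add_mono)
      show "\<bar>fst z' - fst z\<bar> \<le> dist z' z" using dist_fst_le[of z' z] by (simp add: dist_real_def)
      have "\<bar>max 0 (snd z') - max 0 (snd z)\<bar> \<le> \<bar>snd z' - snd z\<bar>" by (simp add: max_def)
      also have "\<dots> \<le> dist z' z" using dist_snd_le[of z' z] by (simp add: dist_real_def)
      finally show "\<bar>max 0 (snd z') - max 0 (snd z)\<bar> \<le> dist z' z" .
    qed (rule \<Lambda>)
    also have "\<dots> \<le> (2 * \<Lambda> + 1) * dist z' z" by (simp add: algebra_simps)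
    also have "\<dots> < \<eta>" using z' \<Lambda> by (simp add: pos_less_divide_eq mult.commute)
    finally show "dist (S (fst z') (max 0 (snd z'))) (S (fst z) (max 0 (snd z))) < \<eta>" by (simp add: dist_real_def)
  qed
qed

lemma continuous_S_compose:
  assumes "continuous_on A f" "continuous_on A g"
  shows "continuous_on A (\<lambda>z. S (f z) (max 0 (g z)))"
  using continuous_on_compose2[OF continuous_S continuous_on_Pair[OF assms]] by simp

lemma continuous_S_zero: "continuous_on A f \<Longrightarrow> continuous_on A (\<lambda>z. S (f z) 0)"
  using continuous_S_compose[OF _ continuous_on_const[of A 0]] by simp

lemma continuous_space_window: "continuous_on UNIV (\<lambda>z. window \<delta> (\<lambda>x. S (fst z) (max 0 x)) (snd z))"
  unfolding window_def
  by (rule continuous_on_window_param) (auto simp: case_prod_unfold intro!: continuous_S_compose continuous_intros)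

lemma continuous_space_window_compose:
  assumes "continuous_on A f" "continuous_on A g"
  shows "continuous_on A (\<lambda>z. window \<delta> (\<lambda>x. S (f z) (max 0 x)) (g z))"
  using continuous_on_compose2[OF continuous_space_window continuous_on_Pair[OF assms]] by simp

lemma continuous_smooth_x: "continuous_on UNIV (\<lambda>(t, x). smooth_x \<epsilon> \<delta> S t x)"
  unfolding smooth_x_def window_def case_prod_unfold
  by (rule continuous_on_window_param)
    (use \<delta> in \<open>auto simp: case_prod_unfold intro!: continuous_S_compose continuous_intros\<close>)

lemma continuous_smooth_t: "continuous_on UNIV (\<lambda>(t, x). smooth_t \<epsilon> \<delta> S t x)"
  unfolding smooth_t_def mean2_t_def case_prod_unfold using \<epsilon>
  by (auto intro!: continuous_S_zero continuous_space_window_compose continuous_intros)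

text \<open>The time derivative is that of the outer window; the space derivative passes under the
  time integral.\<close>

lemma mean2_has_derivative:
  "((\<lambda>(t, x). mean2 \<epsilon> \<delta> S t x) has_derivative (\<lambda>(dt, dx). mean2_t \<epsilon> \<delta> S t x * dt + smooth_x \<epsilon> \<delta> S t x * dx)) (at (t, x))"
proof -
  have "((\<lambda>(t, x). mean2 \<epsilon> \<delta> S t x) has_derivative (\<lambda>(dt, dx). mean2_t \<epsilon> \<delta> S t x * dt + smooth_x \<epsilon> \<delta> S t x * dx))
      (at (t, x) within UNIV \<times> UNIV)"
  proof (rule has_derivative_two_variables)
    show "((\<lambda>t. mean2 \<epsilon> \<delta> S t x) has_real_derivative mean2_t \<epsilon> \<delta> S t x) (at t)"
      unfolding mean2_def mean2_t_def
      by (rule window_has_derivative[OF \<epsilon>]) (intro continuous_space_window_compose continuous_intros)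
    fix t x :: real
    have "((\<lambda>x. integral (cbox 0 \<epsilon>) (\<lambda>a. window \<delta> (\<lambda>x. S (t + a) (max 0 x)) x)) has_real_derivative
        integral (cbox 0 \<epsilon>) (\<lambda>a. (S (t + a) (max 0 (x + \<delta>)) - S (t + a) (max 0 x)) / \<delta>)) (at x within UNIV)"
    proof (rule leibniz_rule_field_derivative)
      show "((\<lambda>x. window \<delta> (\<lambda>x. S (t + a) (max 0 x)) x) has_real_derivative
          (S (t + a) (max 0 (x + \<delta>)) - S (t + a) (max 0 x)) / \<delta>) (at x within UNIV)" for x a
        using window_has_derivative[OF \<delta>, of "\<lambda>x. S (t + a) (max 0 x)" x]
        by (simp add: continuous_S_compose)
      show "(\<lambda>a. window \<delta> (\<lambda>x. S (t + a) (max 0 x)) x) integrable_on cbox 0 \<epsilon>" for x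
        by (rule integrable_continuous) (intro continuous_space_window_compose continuous_intros)
      show "continuous_on (UNIV \<times> cbox 0 \<epsilon>) (\<lambda>(x, a). (S (t + a) (max 0 (x + \<delta>)) - S (t + a) (max 0 x)) / \<delta>)"
        unfolding case_prod_unfold using \<delta> by (auto intro!: continuous_S_compose continuous_intros)
    qed auto
    from DERIV_cdivide[OF this, of \<epsilon>]
    show "((\<lambda>x. mean2 \<epsilon> \<delta> S t x) has_real_derivative smooth_x \<epsilon> \<delta> S t x) (at x)"
      unfolding mean2_def smooth_x_def window_def[of \<epsilon>] by simp
  qed (use continuous_smooth_x in auto)
  then show ?thesis by simp
qed

lemma smooth_has_derivative:
  "((\<lambda>(t, x). smooth \<epsilon> \<delta> S t x) has_derivative (\<lambda>(dt, dx). smooth_t \<epsilon> \<delta> S t x * dt + smooth_x \<epsilon> \<delta> S t x * dx)) (at (t, x))"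
proof -
  have S0: "continuous_on UNIV (\<lambda>t. S t 0)" by (intro continuous_S_zero continuous_intros)
  have "((\<lambda>(t, x). smooth \<epsilon> \<delta> S t x) has_derivative (\<lambda>(dt, dx). smooth_t \<epsilon> \<delta> S t x * dt + smooth_x \<epsilon> \<delta> S t x * dx))
      (at (t, x) within UNIV \<times> UNIV)"
  proof (rule has_derivative_two_variables)
    have mt: "((\<lambda>t. mean2 \<epsilon> \<delta> S t x) has_real_derivative mean2_t \<epsilon> \<delta> S t x) (at t)" for t x
      unfolding mean2_def mean2_t_def
      by (rule window_has_derivative[OF \<epsilon>]) (intro continuous_space_window_compose continuous_intros)
    show "((\<lambda>t. smooth \<epsilon> \<delta> S t x) has_real_derivative smooth_t \<epsilon> \<delta> S t x) (at t)"
      unfolding smooth_def smooth_t_def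
      by (intro DERIV_add DERIV_diff mt window_has_derivative[OF \<epsilon> S0])
  next
    fix t x :: real
    have "((\<lambda>x. (t, x)) has_derivative (\<lambda>d. (0, d))) (at x)" by (auto intro!: derivative_eq_intros)
    from has_derivative_compose[OF this mean2_has_derivative]
    have "((\<lambda>x. mean2 \<epsilon> \<delta> S t x) has_real_derivative smooth_x \<epsilon> \<delta> S t x) (at x)"
      by (simp add: has_field_derivative_def)
    then show "((\<lambda>x. smooth \<epsilon> \<delta> S t x) has_real_derivative smooth_x \<epsilon> \<delta> S t x) (at x)"
      unfolding smooth_def by (auto intro!: derivative_eq_intros)
  qed (use continuous_smooth_x in auto)
  then show ?thesis by simp
qed

text \<open>\<open>mean2\<close> is within \<open>\<Lambda> * (\<epsilon> + \<delta>)\<close> of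
  \<open>S\<close>; the vertex correction compares time averages of two functions that are
  \<open>\<Lambda> * \<delta>\<close>-close.\<close>

lemma smooth_close:
  assumes "0 \<le> x"
  shows "\<bar>smooth \<epsilon> \<delta> S t x - S t x\<bar> \<le> \<Lambda> * (\<epsilon> + 2 * \<delta>)"
proof -
  have sw: "\<bar>window \<delta> (\<lambda>x. S t (max 0 x)) x - S t' x\<bar> \<le> \<Lambda> * (\<bar>t - t'\<bar> + \<delta>)" if "0 \<le> x" for t t' x
  proof (rule window_close[OF \<delta>])
    show "continuous_on UNIV (\<lambda>x. S t (max 0 x))" by (intro continuous_S_compose continuous_intros)
    fix b assume b: "0 \<le> b" "b \<le> \<delta>"
    have "\<bar>S t (max 0 (x + b)) - S t' x\<bar> \<le> \<Lambda> * (\<bar>t - t'\<bar> + \<bar>max 0 (x + b) - x\<bar>)"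
      using that by (intro Lip) auto
    also have "\<dots> \<le> \<Lambda> * (\<bar>t - t'\<bar> + \<delta>)" using that b \<Lambda> by (intro mult_left_mono) auto
    finally show "\<bar>S t (max 0 (x + b)) - S t' x\<bar> \<le> \<Lambda> * (\<bar>t - t'\<bar> + \<delta>)" .
  qed
  have csw: "continuous_on UNIV (\<lambda>t. window \<delta> (\<lambda>x. S t (max 0 x)) x)" for x
    by (intro continuous_space_window_compose continuous_intros)
  have S0: "continuous_on UNIV (\<lambda>t. S t 0)" by (intro continuous_S_zero continuous_intros)
  have 1: "\<bar>mean2 \<epsilon> \<delta> S t x - S t x\<bar> \<le> \<Lambda> * (\<epsilon> + \<delta>)"
    unfolding mean2_def
  proof (rule window_close[OF \<epsilon> csw])
    fix a assume a: "0 \<le> a" "a \<le> \<epsilon>"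
    have "\<Lambda> * (\<bar>t + a - t\<bar> + \<delta>) \<le> \<Lambda> * (\<epsilon> + \<delta>)" using a \<Lambda> by (intro mult_left_mono) auto
    then show "\<bar>window \<delta> (\<lambda>x. S (t + a) (max 0 x)) x - S t x\<bar> \<le> \<Lambda> * (\<epsilon> + \<delta>)"
      using sw[OF assms, of "t + a" t] by linarith
  qed
  have 2: "mean2 \<epsilon> \<delta> S t 0 \<le> window \<epsilon> (\<lambda>t. S t 0) t + \<Lambda> * \<delta>"
    "window \<epsilon> (\<lambda>t. S t 0) t \<le> mean2 \<epsilon> \<delta> S t 0 + \<Lambda> * \<delta>"
    unfolding mean2_def
    by (rule window_le[OF \<epsilon> csw S0] window_le[OF \<epsilon> S0 csw], use sw[of 0 "t + a" "t + a" for a] in \<open>force simp: abs_le_iff algebra_simps\<close>)+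
  show ?thesis using 1 2 unfolding smooth_def by (simp add: abs_le_iff algebra_simps)
qed

text \<open>Averaging shifts both ends of a line by the same amount, to the right in space, so
  \<open>mean2\<close> inherits the inequality along lines and, by differentiation, the bound
  \<open>l q\<close>. The time derivative of the vertex correction is a quotient by
  \<open>\<epsilon>\<close> of a difference of two quantities of size
  \<open>\<Lambda> * \<delta>\<close>.\<close>

lemma smooth_pde:
  assumes est: "\<And>t h x y. 0 < h \<Longrightarrow> 0 \<le> x \<Longrightarrow> 0 \<le> y \<Longrightarrow> S (t + h) y \<le> S t x + h * l ((y - x) / h)"
    and x: "0 \<le> x" "0 < x \<or> q \<le> 0"
  shows "smooth_t \<epsilon> \<delta> S t x + q * smooth_x \<epsilon> \<delta> S t x \<le> l q + 2 * \<Lambda> * \<delta> / \<epsilon>"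
proof -
  have csw: "continuous_on UNIV (\<lambda>t. window \<delta> (\<lambda>x. S t (max 0 x)) x)" for x
    by (intro continuous_space_window_compose continuous_intros)
  have cS: "continuous_on UNIV (\<lambda>x. S t (max 0 x))" for t by (intro continuous_S_compose continuous_intros)
  have m: "mean2 \<epsilon> \<delta> S (t + h) y \<le> mean2 \<epsilon> \<delta> S t x + h * l ((y - x) / h)" if "0 < h" "0 \<le> x" "0 \<le> y" for t h x y
    unfolding mean2_def
  proof (rule window_le[OF \<epsilon> csw csw], rule window_le[OF \<delta> cS cS])
    fix a b :: real assume "0 \<le> a" "0 \<le> b"
    then show "S (t + h + a) (max 0 (y + b)) \<le> S (t + a) (max 0 (x + b)) + h * l ((y - x) / h)"
      using est[of h "x + b" "y + b" "t + a"] that by (simp add: algebra_simps)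
  qed
  \<comment> \<open>For \<open>q > 0\<close> the backward line stays in the branch up to time
    \<open>x / q\<close>; for \<open>q \<le> 0\<close> it never leaves.\<close>
  define h0 where "h0 = (if q \<le> 0 then 1 else x / q)"
  have h0: "0 < h0" using x by (auto simp: h0_def)
  have "mean2_t \<epsilon> \<delta> S t x + q * smooth_x \<epsilon> \<delta> S t x \<le> l q"
  proof (rule derivative_along_line_le[OF mean2_has_derivative h0])
    fix h assume h: "0 < h" "h < h0"
    have "0 \<le> x - q * h"
    proof (cases "q \<le> 0")
      case True
      then have "q * h \<le> 0" using h by (simp add: mult_nonpos_nonneg)
      then show ?thesis using x by linarith
    next
      case False
      then have "h < x / q" using h by (simp add: h0_def)
      then show ?thesis using False by (simp add: pos_less_divide_eq mult.commute)
    qed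
    then show "mean2 \<epsilon> \<delta> S t x \<le> mean2 \<epsilon> \<delta> S (t - h) (x - q * h) + h * l q"
      using m[of h "x - q * h" x "t - h"] h x by simp
  qed
  moreover have "\<bar>mean2_t \<epsilon> \<delta> S t 0 - (S (t + \<epsilon>) 0 - S t 0) / \<epsilon>\<bar> \<le> 2 * \<Lambda> * \<delta> / \<epsilon>"
  proof -
    have w: "\<bar>window \<delta> (\<lambda>x. S t (max 0 x)) 0 - S t 0\<bar> \<le> \<Lambda> * \<delta>" for t
    proof (rule window_close[OF \<delta> cS])
      fix b assume b: "0 \<le> b" "b \<le> \<delta>"
      have "\<bar>S t (max 0 (0 + b)) - S t 0\<bar> \<le> \<Lambda> * (\<bar>t - t\<bar> + \<bar>max 0 (0 + b) - 0\<bar>)" by (intro Lip) auto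
      also have "\<dots> \<le> \<Lambda> * \<delta>" using b \<Lambda> by (intro mult_left_mono) auto
      finally show "\<bar>S t (max 0 (0 + b)) - S t 0\<bar> \<le> \<Lambda> * \<delta>" .
    qed
    have "mean2_t \<epsilon> \<delta> S t 0 - (S (t + \<epsilon>) 0 - S t 0) / \<epsilon> =
       ((window \<delta> (\<lambda>x. S (t + \<epsilon>) (max 0 x)) 0 - S (t + \<epsilon>) 0) - (window \<delta> (\<lambda>x. S t (max 0 x)) 0 - S t 0)) / \<epsilon>"
      unfolding mean2_t_def by (simp add: diff_divide_distrib)
    moreover have "\<bar>(window \<delta> (\<lambda>x. S (t + \<epsilon>) (max 0 x)) 0 - S (t + \<epsilon>) 0) - (window \<delta> (\<lambda>x. S t (max 0 x)) 0 - S t 0)\<bar> \<le> 2 * \<Lambda> * \<delta>"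
      using w[of t] w[of "t + \<epsilon>"] by linarith
    ultimately show ?thesis using \<epsilon> by (simp add: abs_divide divide_right_mono)
  qed
  ultimately show ?thesis unfolding smooth_t_def by linarith
qed

end

subsection \<open>Comparison\<close>

text \<open>At a maximum of \<open>\<Phi> - v\<close> at positive time, \<open>strict\<close> and
  the supremum over \<open>q\<close> (over \<open>q \<le> 0\<close> at the vertex) bound time
  derivative plus Hamiltonian by \<open>-\<eta>\<close>, against the supersolution inequality. Hence
  the maximum sits at time 0, where \<open>init\<close> applies.\<close>

lemma strict_subsolution_le_supersolution:
  fixes \<Phi> pt px :: "nat \<Rightarrow> real \<Rightarrow> real \<Rightarrow> real"
  assumes adm: "admissible_junction N e" and T: "0 < T" and super: "supersolution N e L T v"
    and C1: "C1_branches N T \<Phi> pt px"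
    and cont: "\<And>i. i \<in> {1..N} \<Longrightarrow> continuous_on ({0..<T} \<times> {0..}) (\<lambda>(t, s). \<Phi> i t s)"
    and pt0: "\<And>i t. i \<in> {1..N} \<Longrightarrow> pt i t 0 = pt 1 t 0"
    and bnd: "\<And>i t s. i \<in> {1..N} \<Longrightarrow> 0 \<le> t \<Longrightarrow> t < T \<Longrightarrow> 0 \<le> s \<Longrightarrow> \<Phi> i t s - v t (s *\<^sub>R e i) \<le> Q - s - \<theta> / (T - t)"
    and \<theta>: "0 < \<theta>" and \<eta>: "0 < \<eta>"
    and strict: "\<And>i t s q. i \<in> {1..N} \<Longrightarrow> 0 < t \<Longrightarrow> t < T \<Longrightarrow> 0 \<le> s \<Longrightarrow> 0 < s \<or> q \<le> 0 \<Longrightarrow>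
        pt i t s + q * px i t s \<le> L i q - \<eta>"
    and init: "\<And>i s. i \<in> {1..N} \<Longrightarrow> 0 \<le> s \<Longrightarrow> \<Phi> i 0 s \<le> v 0 (s *\<^sub>R e i) + m"
    and i: "i \<in> {1..N}" and t: "0 \<le> t" "t < T" and s: "0 \<le> s"
  shows "\<Phi> i t s \<le> v t (s *\<^sub>R e i) + m"
proof -
  define f where "f i t s = \<Phi> i t s - v t (s *\<^sub>R e i)" for i t s
  have N1: "1 \<le> N" using adm by (simp add: admissible_junction_def)
  have lsc: "lsc_J N e T v" using super by (simp add: supersolution_def)
  have uscf: "\<exists>\<delta>>0. \<forall>t' s'. 0 \<le> t' \<and> t' < T \<and> 0 \<le> s' \<and> \<bar>t' - t\<bar> < \<delta> \<and> \<bar>s' - s\<bar> < \<delta> \<longrightarrow> f i t' s' < f i t s + \<epsilon>"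
    if "i \<in> {1..N}" "0 \<le> t" "t < T" "0 \<le> s" "0 < \<epsilon>" for i t s \<epsilon>
    using usc_add_continuous[of 0 T t s "\<lambda>t s. - v t (s *\<^sub>R e i)" "\<Phi> i", OF lsc_J_branch[OF adm lsc that(1-4)]
        cont[OF that(1)] that(2-5)] by (simp add: f_def)
  have bndf: "f i t s \<le> Q - s - \<theta> / (T - t)" if "i \<in> {1..N}" "0 \<le> t" "t < T" "0 \<le> s" for i t s
    unfolding f_def by (rule bnd[OF that])
  obtain k t0 s0 where k: "k \<in> {1..N}" and t0: "0 \<le> t0" "t0 < T" and s0: "0 \<le> s0"
    and max: "\<And>i t' s'. i \<in> {1..N} \<Longrightarrow> 0 \<le> t' \<Longrightarrow> t' < T \<Longrightarrow> 0 \<le> s' \<Longrightarrow> f i t' s' \<le> f k t0 s0"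
    by (rule coercive_usc_attains_max[OF N1 T \<theta> uscf bndf]) (assumption | blast)+
  have "t0 = 0"
  proof (rule ccontr)
    assume "t0 \<noteq> 0"
    then have pos: "0 < t0" using t0 by simp
    have mx: "\<Phi> i t' s' - v t' (s' *\<^sub>R e i) \<le> \<Phi> k t0 s0 - v t0 (s0 *\<^sub>R e k)"
      if "i \<in> {1..N}" "0 < t'" "t' < T" "\<bar>t' - t0\<bar> < 1" "0 \<le> s'" for i t' s'
      using max[of i t' s'] that by (simp add: f_def)
    show False
    proof (cases "s0 = 0")
      case True
      obtain j where j: "j \<in> {1..N}" "0 \<le> pt 1 t0 0 + Hi_minus L j (px j t0 0)"
        using supersolution_test(2)[OF adm super C1 k pos t0(2) s0 zero_less_one mx True] by blast
      have "Hi_minus L j (px j t0 0) \<le> - pt j t0 0 - \<eta>"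
      proof (rule Hi_minus_le)
        fix q :: real assume "q \<le> 0"
        then show "px j t0 0 * q - L j q \<le> - pt j t0 0 - \<eta>"
          using strict[OF j(1) pos t0(2), of 0 q] by (simp add: mult.commute)
      qed
      \<comment> \<open>The vertex condition reads the time derivative on branch 1, while the
        maximum of the Hamiltonians may be attained on branch \<open>j\<close>; \<open>pt0\<close>
        reconciles them.\<close>
      then show False using j pt0[OF j(1), of t0] \<eta> by linarith
    next
      case False
      then have s0': "0 < s0" using s0 by simp
      have "0 \<le> pt k t0 s0 + Hi L k (px k t0 s0)"
        using supersolution_test(1)[OF adm super C1 k pos t0(2) s0 zero_less_one mx s0'] by blast
      moreover have "Hi L k (px k t0 s0) \<le> - pt k t0 s0 - \<eta>"
      proof (rule Hi_le)
        fix q :: real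
        show "px k t0 s0 * q - L k q \<le> - pt k t0 s0 - \<eta>"
          using strict[OF k pos t0(2) s0, of q] s0' by (simp add: mult.commute)
      qed
      ultimately show False using \<eta> by linarith
    qed
  qed
  then show ?thesis using max[OF i t s] init[OF k s0] by (simp add: f_def)
qed

text \<open>Capping the subsolution by a decreasing cone makes it coercive from above, and prolonging it to
  negative times by the initial datum lets the running supremum see the initial condition.\<close>
definition capped :: "(nat \<Rightarrow> real^2) \<Rightarrow> (real \<Rightarrow> real^2 \<Rightarrow> real) \<Rightarrow> (real^2 \<Rightarrow> real) \<Rightarrow> real \<Rightarrow> real \<Rightarrow> real
    \<Rightarrow> nat \<Rightarrow> real \<Rightarrow> real \<Rightarrow> real" where
  "capped e u u0 R K A i t s =
     min (if t \<le> 0 then u0 (s *\<^sub>R e i) else u t (s *\<^sub>R e i) + R * t) (A - K * s)"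

text \<open>A minimum inherits the inequality from its two entries. For the cone, and for the
  initial datum at negative times, it reduces to \<open>K * |q| \<le> L i q + R\<close>; a line
  crossing time 0 is cut there.\<close>

lemma capped_estimate:
  assumes est: "\<And>t h x y. 0 \<le> t \<Longrightarrow> 0 < h \<Longrightarrow> t + h < T \<Longrightarrow> 0 \<le> x \<Longrightarrow> 0 \<le> y \<Longrightarrow>
      u (t + h) (y *\<^sub>R e i) \<le> u t (x *\<^sub>R e i) + h * L i ((y - x) / h)"
    and init: "\<And>s. 0 \<le> s \<Longrightarrow> u 0 (s *\<^sub>R e i) \<le> u0 (s *\<^sub>R e i)"
    and Lip: "\<And>x y. 0 \<le> x \<Longrightarrow> 0 \<le> y \<Longrightarrow> u0 (y *\<^sub>R e i) \<le> u0 (x *\<^sub>R e i) + K * \<bar>y - x\<bar>"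
    and R: "\<And>q. K * \<bar>q\<bar> \<le> L i q + R" and K: "0 \<le> K"
    and h: "0 < h" "t + h < T" and x: "0 \<le> x" "0 \<le> y"
  shows "capped e u u0 R K A i (t + h) y \<le> capped e u u0 R K A i t x + h * (L i ((y - x) / h) + R)"
proof -
  define q where "q = (y - x) / h"
  have y: "y = x + q * h" using h by (simp add: q_def)
  have cone: "K * \<bar>q\<bar> * h \<le> h * (L i q + R)" using R[of q] h by (simp add: mult.commute mult_left_mono)
  have "A - K * y \<le> A - K * x + h * (L i q + R)"
  proof -
    have "- (K * (q * h)) \<le> K * \<bar>q\<bar> * h"
    proof -
      have "- (q * h) \<le> \<bar>q\<bar> * h" using h abs_ge_minus_self[of "q * h"] by (simp add: abs_mult)
      from mult_left_mono[OF this K] show ?thesis by (simp add: algebra_simps)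
    qed
    then show ?thesis using cone unfolding y by (simp add: distrib_left)
  qed
  moreover have "(if t + h \<le> 0 then u0 (y *\<^sub>R e i) else u (t + h) (y *\<^sub>R e i) + R * (t + h))
      \<le> (if t \<le> 0 then u0 (x *\<^sub>R e i) else u t (x *\<^sub>R e i) + R * t) + h * (L i q + R)"
  proof -
    consider "t + h \<le> 0" | "t \<le> 0" "0 < t + h" | "0 < t" by linarith
    then show ?thesis
    proof cases
      case 1
      have "K * \<bar>y - x\<bar> = K * \<bar>q\<bar> * h" unfolding y using h by (simp add: abs_mult)
      then have "u0 (y *\<^sub>R e i) \<le> u0 (x *\<^sub>R e i) + h * (L i q + R)" using Lip[OF x] cone by linarith
      then show ?thesis using 1 h by simp
    next
      case 2
      \<comment> \<open>The position at time 0. It is a convex combination of \<open>x\<close> and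
        \<open>y\<close>, hence stays in the branch.\<close>
      define z where "z = x + q * (- t)"
      have z: "0 \<le> z"
      proof -
        have "z * h = (t + h) * x + (- t) * y" unfolding z_def y by (simp add: algebra_simps)
        moreover have "0 \<le> (t + h) * x" "0 \<le> (- t) * y" using 2 x by (auto intro!: mult_nonneg_nonneg mult_nonpos_nonneg)
        ultimately have "0 \<le> z * h" by linarith
        then show ?thesis using h by (simp add: zero_le_mult_iff)
      qed
      have "(y - z) / (t + h) = q" unfolding z_def y using 2 by (simp add: field_simps)
      then have "u (t + h) (y *\<^sub>R e i) \<le> u 0 (z *\<^sub>R e i) + (t + h) * L i q"
        using est[of 0 "t + h" z y] 2 h z x by simp
      moreover have "u0 (z *\<^sub>R e i) \<le> u0 (x *\<^sub>R e i) + (- t) * (L i q + R)"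
      proof -
        have "u0 (z *\<^sub>R e i) \<le> u0 (x *\<^sub>R e i) + K * \<bar>z - x\<bar>" by (rule Lip[OF x(1) z])
        also have "K * \<bar>z - x\<bar> = (- t) * (K * \<bar>q\<bar>)" unfolding z_def using 2 by (simp add: abs_mult)
        also have "\<dots> \<le> (- t) * (L i q + R)" using R[of q] 2 by (intro mult_left_mono) auto
        finally show ?thesis by simp
      qed
      ultimately show ?thesis using 2 init[OF z] by (simp add: algebra_simps)
    next
      case 3
      then show ?thesis using est[of t h x y] h x by (simp add: q_def algebra_simps)
    qed
  qed
  ultimately show ?thesis unfolding capped_def q_def[symmetric] by linarith
qed


section \<open>Choice of the constants and conclusion\<close>

theorem mainTheorem2:
  fixes N :: nat and e :: "nat \<Rightarrow> real^2" and L :: "nat \<Rightarrow> real \<Rightarrow> real"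
    and u0 :: "real^2 \<Rightarrow> real" and T :: real and u v :: "real \<Rightarrow> real^2 \<Rightarrow> real"
  assumes "admissible_junction N e"
    and "lipschitz_J N e u0"
    and "A1 N L"
    and "T > 0"
    and "subsolution N e L T u" and "\<forall>x\<in>junction N e. u 0 x \<le> u0 x"
    and "supersolution N e L T v" and "\<forall>x\<in>junction N e. v 0 x \<ge> u0 x"
    and "\<exists>C>0. \<forall>t\<in>{0<..<T}. \<forall>x\<in>junction N e.
            u t x \<le> C * (1 + jdist N e x 0) \<and> v t x \<ge> - C * (1 + jdist N e x 0)"
  shows "\<forall>t\<in>{0<..<T}. \<forall>x\<in>junction N e. u t x \<le> v t x"
proof (rule ccontr)
  note adm = assms(1) and A1 = assms(3) and T = assms(4) and sub = assms(5) and super = assms(7)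
  assume "\<not> ?thesis"
  then obtain t1 x where t1: "0 < t1" "t1 < T" and x: "x \<in> junction N e" "v t1 x < u t1 x" by force
  obtain i1 x1 where i1: "i1 \<in> {1..N}" "0 \<le> x1" "x = x1 *\<^sub>R e i1" using junction_cases[OF x(1)] by blast
  define \<beta> where "\<beta> = u t1 x - v t1 x"
  have \<beta>: "0 < \<beta>" using x by (simp add: \<beta>_def)

  obtain C0 where C0: "0 < C0" and growth0: "\<And>t x. t \<in> {0<..<T} \<Longrightarrow> x \<in> junction N e \<Longrightarrow>
      u t x \<le> C0 * (1 + jdist N e x 0) \<and> v t x \<ge> - C0 * (1 + jdist N e x 0)" using assms(9) by blast
  obtain K0 where K0: "\<And>x y. x \<in> junction N e \<Longrightarrow> y \<in> junction N e \<Longrightarrow> \<bar>u0 x - u0 y\<bar> \<le> K0 * jdist N e x y"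
    using assms(2) unfolding lipschitz_J_def by blast
  \<comment> \<open>One constant for the growth of \<open>u\<close>, \<open>v\<close> and
    \<open>u0\<close>. Taking \<open>K\<close> larger by 1 leaves the term \<open>- s\<close> in the
    coercivity bound for \<open>\<Phi> - v\<close>.\<close>
  define C where "C = C0 + \<bar>u0 0\<bar> + \<bar>K0\<bar>"
  define K where "K = C + 1"
  have C: "0 < C" "C0 \<le> C" "\<bar>u0 0\<bar> \<le> C" "\<bar>K0\<bar> \<le> C" using C0 by (auto simp: C_def)
  have jd: "jdist N e (s *\<^sub>R e i) 0 = s" if "i \<in> {1..N}" "0 \<le> s" for i s
    using jdist_zero(2)[of N e "s *\<^sub>R e i"] norm_scaleR_e[OF adm that] by simp
  have growth: "u t (s *\<^sub>R e i) \<le> C * (1 + s)" "- C * (1 + s) \<le> v t (s *\<^sub>R e i)"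
    if "0 < t" "t < T" "i \<in> {1..N}" "0 \<le> s" for t i s
  proof -
    have "C0 * (1 + s) \<le> C * (1 + s)" using C that by (intro mult_right_mono) auto
    moreover have "u t (s *\<^sub>R e i) \<le> C0 * (1 + s) \<and> - C0 * (1 + s) \<le> v t (s *\<^sub>R e i)"
      using growth0[of t "s *\<^sub>R e i"] scaleR_in_junction[OF that(3,4)] jd[OF that(3,4)] that by simp
    ultimately show "u t (s *\<^sub>R e i) \<le> C * (1 + s)" "- C * (1 + s) \<le> v t (s *\<^sub>R e i)"
      by linarith+
  qed
  have u0Lip: "u0 (y *\<^sub>R e i) \<le> u0 (x *\<^sub>R e i) + K * \<bar>y - x\<bar>" if "i \<in> {1..N}" "0 \<le> x" "0 \<le> y" for i x y
  proof -
    have "\<bar>u0 (y *\<^sub>R e i) - u0 (x *\<^sub>R e i)\<bar> \<le> K0 * \<bar>y - x\<bar>"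
      using K0[of "y *\<^sub>R e i" "x *\<^sub>R e i"] scaleR_in_junction jdist_same_branch[OF adm that(1,3,2)] that by simp
    also have "\<dots> \<le> K * \<bar>y - x\<bar>" using C by (intro mult_right_mono) (auto simp: K_def)
    finally show ?thesis by linarith
  qed
  \<comment> \<open>The growth hypothesis concerns positive times; at time 0 the bound comes from
    \<open>u0\<close> and its Lipschitz constant.\<close>
  have vlow: "- C * (1 + s) \<le> v t (s *\<^sub>R e i)" if "0 \<le> t" "t < T" "i \<in> {1..N}" "0 \<le> s" for t i s
  proof (cases "t = 0")
    case True
    have J: "0 \<in> junction N e" using scaleR_in_junction[OF that(3), of 0] by simp
    have "\<bar>u0 (s *\<^sub>R e i) - u0 0\<bar> \<le> K0 * s"
      using K0[OF scaleR_in_junction[OF that(3,4)] J] jd[OF that(3,4)] by simp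
    also have "\<dots> \<le> C * s" using C that by (intro mult_right_mono) auto
    finally have "- C * (1 + s) \<le> u0 (s *\<^sub>R e i)" using C(3) by (simp add: algebra_simps abs_le_iff)
    also have "\<dots> \<le> v t (s *\<^sub>R e i)" using assms(8) scaleR_in_junction[OF that(3,4)] True by blast
    finally show ?thesis .
  next
    case False then show ?thesis using growth(2)[of t i s] that by simp
  qed

  have "\<forall>i\<in>{1..N}. \<exists>r. \<forall>q. K * \<bar>q\<bar> - L i q \<le> r" using superlinear_of_A1[OF A1] by blast
  from bchoice[OF this] obtain r where r: "\<And>i q. i \<in> {1..N} \<Longrightarrow> K * \<bar>q\<bar> - L i q \<le> r i" by blast
  define R where "R = (\<Sum>i\<in>{1..N}. \<bar>r i\<bar>)"
  have R: "K * \<bar>q\<bar> \<le> L i q + R" if "i \<in> {1..N}" for i q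
  proof -
    have "\<bar>r i\<bar> \<le> R" unfolding R_def by (rule member_le_sum) (use that in auto)
    then show ?thesis using r[OF that, of q] by linarith
  qed
  have R0: "0 \<le> R" unfolding R_def by (rule sum_nonneg) simp
  define l where "l i q = L i q + R" for i q
  have l0: "0 \<le> l i q" if "i \<in> {1..N}" for i q
  proof -
    have "0 \<le> K * \<bar>q\<bar>" using C by (simp add: K_def)
    then show ?thesis using R[OF that, of q] by (simp add: l_def)
  qed
  \<comment> \<open>A sum of nonnegative terms dominates each of them; 0, 1 and -1 are the
    velocities behind the Lipschitz bound.\<close>
  define \<Lambda> where "\<Lambda> = (\<Sum>i\<in>{1..N}. l i 0 + l i 1 + l i (-1))"
  have \<Lambda>: "l i 0 \<le> \<Lambda>" "l i 1 \<le> \<Lambda>" "l i (-1) \<le> \<Lambda>" if "i \<in> {1..N}" for i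
  proof -
    have "l i 0 + l i 1 + l i (-1) \<le> \<Lambda>"
      unfolding \<Lambda>_def by (rule member_le_sum) (use that l0 in auto)
    then show "l i 0 \<le> \<Lambda>" "l i 1 \<le> \<Lambda>" "l i (-1) \<le> \<Lambda>"
      using l0[OF that, of 0] l0[OF that, of 1] l0[OF that, of "-1"] by linarith+
  qed
  have \<Lambda>0: "0 \<le> \<Lambda>" using \<Lambda>(1)[OF i1(1)] l0[OF i1(1), of 0] by linarith

  \<comment> \<open>The cone passes through the value of \<open>u t1 x + R * t1\<close> at
    \<open>x1\<close>, so the cap does not lower the function at the point where
    \<open>u > v\<close>.\<close>
  define A where "A = u t1 x + R * t1 + K * x1"
  define E where "E = capped e u u0 R K A"
  have Eub: "E i \<tau> s \<le> A - K * s" for i \<tau> s by (simp add: E_def capped_def)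
  have Eest: "E i (\<tau> + h) y \<le> E i \<tau> x + h * l i ((y - x) / h)"
    if "i \<in> {1..N}" "0 < h" "\<tau> + h < T" "0 \<le> x" "0 \<le> y" for i \<tau> h x y
    unfolding E_def l_def
  proof (rule capped_estimate[where T = T])
    show "u (t + h) (y *\<^sub>R e i) \<le> u t (x *\<^sub>R e i) + h * L i ((y - x) / h)"
      if "0 \<le> t" "0 < h" "t + h < T" "0 \<le> x" "0 \<le> y" for t h x y
      by (rule subsolution_estimate[OF adm A1 sub C(1) growth(1) \<open>i \<in> {1..N}\<close> that])
    show "u 0 (s *\<^sub>R e i) \<le> u0 (s *\<^sub>R e i)" if "0 \<le> s" for s
      using assms(6) scaleR_in_junction[OF \<open>i \<in> {1..N}\<close> that] by blast
    show "0 \<le> K" using C by (simp add: K_def)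
  qed (use that R u0Lip in auto)
  define S where "S i = running_sup T (E i)" for i
  have Sest: "S i (t + h) y \<le> S i t x + h * l i ((y - x) / h)" if "i \<in> {1..N}" "0 < h" "0 \<le> x" "0 \<le> y" for i t h x y
    unfolding S_def by (rule running_sup_estimate[where b = "\<lambda>s. A - K * s"]) (use that Eub Eest in auto)
  have SLip: "\<bar>S i t x - S i t' y\<bar> \<le> \<Lambda> * (\<bar>t - t'\<bar> + \<bar>x - y\<bar>)" if "i \<in> {1..N}" "0 \<le> x" "0 \<le> y" for i t t' x y
    unfolding S_def
    by (rule running_sup_Lipschitz[where b = "\<lambda>s. A - K * s" and l = "l i"]) (use that Eub Eest \<Lambda> in auto)
  have Sub: "S i t s \<le> A - K * s" for i t s
    unfolding S_def by (rule running_sup_least) (rule Eub)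
  have Sinit: "S i 0 s \<le> u0 (s *\<^sub>R e i)" for i s
    unfolding S_def by (rule running_sup_least) (simp add: E_def capped_def)
  have S0: "S i t 0 = S j t 0" for i j t
    unfolding S_def running_sup_def E_def capped_def by (simp only: scaleR_zero_left)
  have S1: "u t1 x + R * t1 \<le> S i1 t1 x1"
  proof -
    have "E i1 t1 x1 \<le> S i1 t1 x1"
      unfolding S_def by (rule running_sup_upper[where B = "A - K * x1"]) (use Eub t1 in auto)
    moreover have "E i1 t1 x1 = u t1 x + R * t1" using t1 i1 by (simp add: E_def capped_def A_def)
    ultimately show ?thesis by simp
  qed

  \<comment> \<open>The gap \<open>\<beta>\<close> is spent in quarters: at most one on the
    \<open>\<theta>\<close> terms at \<open>(t1, x1)\<close>, one on averaging there, and one on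
    averaging at time 0. Three quarters do not reach \<open>\<beta>\<close>.\<close>
  define \<theta> where "\<theta> = \<beta> / (4 * (T + 1 / (T - t1)))"
  have den: "0 < T + 1 / (T - t1)" using t1 by (intro add_pos_pos) auto
  have \<theta>: "0 < \<theta>" unfolding \<theta>_def using \<beta> den by simp
  have \<theta>\<beta>: "\<theta> * T + \<theta> / (T - t1) = \<beta> / 4"
  proof -
    have "\<theta> * (T + 1 / (T - t1)) = \<beta> / 4" unfolding \<theta>_def using den by (simp add: field_simps)
    then show ?thesis by (simp add: algebra_simps)
  qed
  \<comment> \<open>Averaging over length \<open>\<kappa>\<close> in time and
    \<open>\<kappa>^2\<close> in space gives the vertex error
    \<open>2 * \<Lambda> * \<kappa>\<close> and a distance to \<open>S\<close> of at most
    \<open>3 * \<Lambda> * \<kappa>\<close>. The bounds on \<open>\<kappa>\<close> make these at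
    most \<open>\<theta> / 2\<close> and \<open>\<beta> / 4\<close>.\<close>
  define \<kappa> where "\<kappa> = min 1 (min (\<theta> / (4 * (\<Lambda> + 1))) (\<beta> / (12 * (\<Lambda> + 1))))"
  have \<kappa>: "0 < \<kappa>" "\<kappa> \<le> 1" using \<theta> \<beta> \<Lambda>0 by (auto simp: \<kappa>_def)
  have \<kappa>\<theta>: "2 * \<Lambda> * \<kappa>\<^sup>2 / \<kappa> \<le> \<theta> / 2"
  proof -
    have "\<kappa> \<le> \<theta> / (4 * (\<Lambda> + 1))" by (simp add: \<kappa>_def)
    then have "4 * (\<Lambda> + 1) * \<kappa> \<le> \<theta>" using \<Lambda>0 by (simp add: pos_le_divide_eq mult.commute)
    then have "2 * \<Lambda> * \<kappa> \<le> \<theta> / 2" using \<kappa> by (simp add: algebra_simps)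
    then show ?thesis using \<kappa> by (simp add: power2_eq_square)
  qed
  have \<kappa>\<beta>: "\<Lambda> * (\<kappa> + 2 * \<kappa>\<^sup>2) \<le> \<beta> / 4"
  proof -
    have "\<kappa> \<le> \<beta> / (12 * (\<Lambda> + 1))" by (simp add: \<kappa>_def)
    then have "12 * (\<Lambda> + 1) * \<kappa> \<le> \<beta>" using \<Lambda>0 by (simp add: pos_le_divide_eq mult.commute)
    then have "\<Lambda> * (3 * \<kappa>) \<le> \<beta> / 4" using \<kappa> by (simp add: algebra_simps)
    moreover have "\<kappa>\<^sup>2 \<le> \<kappa>" using \<kappa> mult_left_mono[of \<kappa> 1 \<kappa>] by (simp add: power2_eq_square)
    then have "\<Lambda> * (\<kappa> + 2 * \<kappa>\<^sup>2) \<le> \<Lambda> * (3 * \<kappa>)" using \<Lambda>0 by (intro mult_left_mono) auto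
    ultimately show ?thesis by linarith
  qed

  define W where "W i = smooth \<kappa> (\<kappa>\<^sup>2) (S i)" for i
  have \<kappa>2: "0 < \<kappa>\<^sup>2" using \<kappa> by simp
  have Wclose: "\<bar>W i t s - S i t s\<bar> \<le> \<beta> / 4" if "i \<in> {1..N}" "0 \<le> s" for i t s
    using smooth_close[of \<kappa> "\<kappa>\<^sup>2" \<Lambda> "S i", OF \<kappa>(1) \<kappa>2 \<Lambda>0 SLip[OF that(1)] that(2), of t] \<kappa>\<beta> unfolding W_def by linarith
  \<comment> \<open>\<open>R * t\<close> undoes the shift of the Lagrangians,
    \<open>\<theta> * t\<close> gives strictness, half of which the vertex error may consume, and
    \<open>\<theta> / (T - t)\<close> keeps the maximum away from \<open>T\<close>.\<close>
  define \<Phi> where "\<Phi> i t s = W i t s - R * t - \<theta> * t - \<theta> / (T - t)" for i t s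
  define pt where "pt i t s = smooth_t \<kappa> (\<kappa>\<^sup>2) (S i) t s - R - \<theta> - \<theta> / (T - t)\<^sup>2" for i t s
  define px where "px i t s = smooth_x \<kappa> (\<kappa>\<^sup>2) (S i) t s" for i t s
  have deriv: "((\<lambda>(t', s'). \<Phi> i t' s') has_derivative (\<lambda>(dt, ds). pt i t s * dt + px i t s * ds)) (at (t, s))"
    if i: "i \<in> {1..N}" and t: "t < T" for i t s
  proof -
    have W: "((\<lambda>z. case z of (t', s') \<Rightarrow> W i t' s') has_derivative
        (\<lambda>d. case d of (dt, ds) \<Rightarrow> smooth_t \<kappa> (\<kappa>\<^sup>2) (S i) t s * dt + px i t s * ds)) (at (t, s))"
      unfolding W_def px_def by (rule smooth_has_derivative[of \<kappa> "\<kappa>\<^sup>2" \<Lambda> "S i", OF \<kappa>(1) \<kappa>2 \<Lambda>0 SLip[OF i]])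
    have "((\<lambda>t. R * t + \<theta> * t + \<theta> / (T - t)) has_real_derivative R + \<theta> + \<theta> / (T - t)\<^sup>2) (at t)"
      using t by (auto intro!: derivative_eq_intros simp: power2_eq_square)
    then have c: "((\<lambda>t. R * t + \<theta> * t + \<theta> / (T - t)) has_derivative (\<lambda>d. (R + \<theta> + \<theta> / (T - t)\<^sup>2) * d)) (at (fst (t, s)))"
      by (simp add: has_field_derivative_def)
    have "(fst has_derivative fst) (at (t, s))" by (rule has_derivative_fst[OF has_derivative_ident])
    note D = has_derivative_diff[OF W has_derivative_compose[OF this c]]
    have "(\<lambda>(t', s'). \<Phi> i t' s') = (\<lambda>z. (case z of (t', s') \<Rightarrow> W i t' s') - (R * fst z + \<theta> * fst z + \<theta> / (T - fst z)))"
      by (auto simp: \<Phi>_def fun_eq_iff)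
    moreover have "(\<lambda>(dt, ds). pt i t s * dt + px i t s * ds) = (\<lambda>d. (case d of (dt, ds) \<Rightarrow>
        smooth_t \<kappa> (\<kappa>\<^sup>2) (S i) t s * dt + px i t s * ds) - (R + \<theta> + \<theta> / (T - t)\<^sup>2) * fst d)"
      by (auto simp: pt_def fun_eq_iff algebra_simps)
    ultimately show ?thesis using D by (simp only:)
  qed
  have C1: "C1_branches N T \<Phi> pt px"
    unfolding C1_branches_def
  proof (intro conjI ballI allI)
    fix i j t
    show "\<Phi> i t 0 = \<Phi> j t 0" unfolding \<Phi>_def W_def smooth_def using S0[of i _ j] by simp
  next
    fix i assume i: "i \<in> {1..N}"
    note sm = \<kappa>(1) \<kappa>2 \<Lambda>0 SLip[OF i]
    have "continuous_on ({0<..<T} \<times> {0..}) (\<lambda>z. (case z of (t, s) \<Rightarrow> smooth_t \<kappa> (\<kappa>\<^sup>2) (S i) t s) - R - \<theta> - \<theta> / (T - fst z)\<^sup>2)"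
      by (intro continuous_intros continuous_on_subset[OF continuous_smooth_t[of \<kappa> "\<kappa>\<^sup>2" \<Lambda> "S i", OF sm]]) auto
    then show "continuous_on ({0<..<T} \<times> {0..}) (\<lambda>(t, s). pt i t s)"
      unfolding pt_def by (simp add: case_prod_unfold)
    show "continuous_on ({0<..<T} \<times> {0..}) (\<lambda>(t, s). px i t s)"
      unfolding px_def
      by (rule continuous_on_subset[OF continuous_smooth_x[of \<kappa> "\<kappa>\<^sup>2" \<Lambda> "S i", OF sm]]) auto
    fix t s assume "t \<in> {0<..<T}"
    then have "t < T" by simp
    then show "((\<lambda>(t', s'). \<Phi> i t' s') has_derivative (\<lambda>(dt, ds). pt i t s * dt + px i t s * ds))
        (at (t, s) within {0<..<T} \<times> {0..})"
      by (rule has_derivative_at_withinI[OF deriv[OF i]])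
  qed
  have \<Phi>le: "\<Phi> i1 t1 x1 \<le> v t1 (x1 *\<^sub>R e i1) + \<beta> / 4"
  proof (rule strict_subsolution_le_supersolution[OF adm T super C1])
    show "continuous_on ({0..<T} \<times> {0..}) (\<lambda>(t, s). \<Phi> i t s)" if i: "i \<in> {1..N}" for i
    proof (rule has_derivative_continuous_on)
      fix z assume "z \<in> {0..<T} \<times> {0::real..}"
      then have "fst z < T" by auto
      from has_derivative_at_withinI[OF deriv[OF i this], of "snd z"]
      show "((\<lambda>(t, s). \<Phi> i t s) has_derivative
          (\<lambda>(dt, ds). pt i (fst z) (snd z) * dt + px i (fst z) (snd z) * ds)) (at z within {0..<T} \<times> {0..})"
        by simp
    qed
    show "pt i t 0 = pt 1 t 0" for i t unfolding pt_def smooth_t_def using S0[of i _ 1] by simp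
    show "\<Phi> i t s - v t (s *\<^sub>R e i) \<le> (A + \<beta> / 4 + C) - s - \<theta> / (T - t)"
      if "i \<in> {1..N}" "0 \<le> t" "t < T" "0 \<le> s" for i t s
    proof -
      have "0 \<le> R * t" "0 \<le> \<theta> * t" using R0 \<theta> that by auto
      moreover have "K * s = C * s + s" "C * (1 + s) = C + C * s" by (auto simp: K_def algebra_simps)
      ultimately show ?thesis
        using Wclose[OF that(1,4), of t] Sub[of i t s] vlow[OF that(2,3,1,4)] unfolding \<Phi>_def by linarith
    qed
    show "pt i t s + q * px i t s \<le> L i q - \<theta> / 2"
      if "i \<in> {1..N}" "0 < t" "t < T" "0 \<le> s" "0 < s \<or> q \<le> 0" for i t s q
    proof -
      have "smooth_t \<kappa> (\<kappa>\<^sup>2) (S i) t s + q * px i t s \<le> l i q + 2 * \<Lambda> * \<kappa>\<^sup>2 / \<kappa>"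
        unfolding px_def
        by (rule smooth_pde[of \<kappa> "\<kappa>\<^sup>2" \<Lambda> "S i", OF \<kappa>(1) \<kappa>2 \<Lambda>0 SLip[OF that(1)] Sest[OF that(1)] that(4,5)])
      moreover have "0 \<le> \<theta> / (T - t)\<^sup>2" using \<theta> by simp
      ultimately show ?thesis using \<kappa>\<theta> unfolding pt_def l_def by linarith
    qed
    show "\<Phi> i 0 s \<le> v 0 (s *\<^sub>R e i) + \<beta> / 4" if "i \<in> {1..N}" "0 \<le> s" for i s
    proof -
      have "u0 (s *\<^sub>R e i) \<le> v 0 (s *\<^sub>R e i)" using assms(8) scaleR_in_junction[OF that] by blast
      moreover have "0 \<le> \<theta> / (T - 0)" using \<theta> T by simp
      ultimately show ?thesis using Wclose[OF that, of 0] Sinit[of i s] unfolding \<Phi>_def by linarith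
    qed
  qed (use \<theta> i1 t1 in auto)
  have "\<theta> * t1 \<le> \<theta> * T" using \<theta> t1 by (intro mult_left_mono) auto
  then have "u t1 x - \<beta> / 2 \<le> \<Phi> i1 t1 x1"
    using Wclose[OF i1(1,2), of t1] S1 \<theta>\<beta> unfolding \<Phi>_def by linarith
  then have "u t1 x - \<beta> / 2 \<le> v t1 x + \<beta> / 4" using \<Phi>le unfolding i1(3)[symmetric] by (rule order_trans)
  moreover have "u t1 x - v t1 x = \<beta>" by (simp add: \<beta>_def)
  ultimately show False using \<beta> by linarith
qed

end
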